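(* Let $H$ be a stackable group, let $A,B\le H$ be finitely generated subgroups, and let $\psi:A\to B$ be an isomorphism. Then the HNN extension $G=H\ast_\psi=\langle H,s\mid sas^{-1}=\psi(a)\ (a\in A)\rangle$ is also stackable.
   Context: Let $G$ be a group with a finite inverse-closed generating set $X$, no element of which represents the identity. Let $\Gamma=\Gamma(G,X)$ be the Cayley graph, $\vec E$ its set of directed edges and $\vec P$ its set of directed edge paths. For $g\in G$, $a\in X$, $e_{g,a}$ is the directed edge from $g$ to $ga$ labeled $a$; the directed edges $e_{g,a}$ and $e_{ga,a^{-1}}$ are considered to have the same underlying undirected edge. A flow function associated to a maximal tree $\mathcal T$ in $\Gamma$ is a function $\Phi:\vec E\to\vec P$ such that: (F1) for each $e\in\vec E$, the path $\Phi(e)$ has the same initial and terminal vertices as $e$; (F2d) if the undirected edge underlying $e$ lies in $\mathcal T$, then $\Phi(e)=e$; (F2r) the transitive closure $<_\Phi$ of the relation $<$ on $\vec E$, defined by $e'<e$ whenever $e'$ lies on the path $\Phi(e)$ and the undirected edges underlying both $e$ and $e'$ do not lie in $\mathcal T$, is a well-founded strict partial ordering. The flow function is bounded if there is a constant $k$ such that $\Phi(e)$ has length at most $k$ for all $e\in\vec E$. $G$ is stackable over $X$ if there is a bounded flow function on a maximal tree in $\Gamma(G,X)$. A group is stackable if it is stackable over some finite inverse-closed generating set. *)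

theory Defs
  imports "HOL-Algebra.Generated_Groups" "Graph_Theory.Digraph_Component"
begin

section \<open>Cayley graphs and their maximal trees\<close>

definition inv_closed_gen_set :: "('a, 'b) monoid_scheme \<Rightarrow> 'a set \<Rightarrow> bool" where
  "inv_closed_gen_set G X \<longleftrightarrow>
     X \<subseteq> carrier G \<and> finite X \<and> (\<forall>a\<in>X. inv\<^bsub>G\<^esub> a \<in> X) \<and> \<one>\<^bsub>G\<^esub> \<notin> X \<and>
     generate G X = carrier G"

text \<open>The pair \<open>(g, a)\<close> is the directed edge $e_{g,a}$. An undirected edge is the pair consisting of
  a directed edge and its reverse.\<close>

definition cayley_graph :: "('a, 'b) monoid_scheme \<Rightarrow> 'a set \<Rightarrow> ('a, 'a \<times> 'a) pre_digraph" where
  "cayley_graph G X =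
     \<lparr>verts = carrier G, arcs = carrier G \<times> X, tail = fst, head = (\<lambda>(g, a). g \<otimes>\<^bsub>G\<^esub> a)\<rparr>"

definition rev_edge :: "('a, 'b) monoid_scheme \<Rightarrow> 'a \<times> 'a \<Rightarrow> 'a \<times> 'a" where
  "rev_edge G = (\<lambda>(g, a). (g \<otimes>\<^bsub>G\<^esub> a, inv\<^bsub>G\<^esub> a))"

text \<open>Subgraphs of the undirected Cayley graph are subdigraphs closed under edge reversal; thus an
  undirected edge lies in such a subgraph iff either of its directed edges is an arc of it. As
  \<^const>\<open>pre_digraph.cycle\<close> also admits the closed walks \<open>u, v, u\<close> along an edge and back, and the
  Cayley graph has neither loops nor multiple edges, the circuits of the undirected graph are the
  cycles of length at least 3. Note that \<^const>\<open>Digraph_Component.connected\<close> excludes the empty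
  graph, and that \<^const>\<open>Digraph_Component.tree\<close> is not usable here: it forbids \<open>u, v, u\<close>.\<close>

definition undirected_tree :: "('a, 'b) monoid_scheme \<Rightarrow> ('a, 'a \<times> 'a) pre_digraph \<Rightarrow> bool" where
  "undirected_tree G T \<longleftrightarrow>
     (\<forall>e\<in>arcs T. rev_edge G e \<in> arcs T) \<and>
     Digraph_Component.connected T \<and>
     \<not> (\<exists>p. pre_digraph.cycle T p \<and> length p \<ge> 3)"

definition maximal_tree ::
    "('a, 'b) monoid_scheme \<Rightarrow> 'a set \<Rightarrow> ('a, 'a \<times> 'a) pre_digraph \<Rightarrow> bool" where
  "maximal_tree G X T \<longleftrightarrow> pre_digraph.max_subgraph (cayley_graph G X) (undirected_tree G) T"

section \<open>Flow functions and stackability\<close>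

definition flow_less ::
    "('a, 'b) monoid_scheme \<Rightarrow> 'a set \<Rightarrow> ('a, 'a \<times> 'a) pre_digraph \<Rightarrow>
     ('a \<times> 'a \<Rightarrow> ('a \<times> 'a) list) \<Rightarrow> (('a \<times> 'a) \<times> ('a \<times> 'a)) set" where
  "flow_less G X T \<Phi> =
     {(e', e). e \<in> arcs (cayley_graph G X) \<and> e' \<in> set (\<Phi> e) \<and> e \<notin> arcs T \<and> e' \<notin> arcs T}"

text \<open>Only the values of \<open>\<Phi>\<close> on directed edges of the Cayley graph matter.\<close>

definition flow_function ::
    "('a, 'b) monoid_scheme \<Rightarrow> 'a set \<Rightarrow> ('a, 'a \<times> 'a) pre_digraph \<Rightarrow>
     ('a \<times> 'a \<Rightarrow> ('a \<times> 'a) list) \<Rightarrow> bool" where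
  "flow_function G X T \<Phi> \<longleftrightarrow>
     (\<forall>e\<in>arcs (cayley_graph G X). pre_digraph.awalk (cayley_graph G X)
        (tail (cayley_graph G X) e) (\<Phi> e) (head (cayley_graph G X) e)) \<and>
     (\<forall>e\<in>arcs (cayley_graph G X). e \<in> arcs T \<longrightarrow> \<Phi> e = [e]) \<and>
     wf ((flow_less G X T \<Phi>)\<^sup>+) \<and> irrefl ((flow_less G X T \<Phi>)\<^sup>+) \<and> trans ((flow_less G X T \<Phi>)\<^sup>+)"

definition bounded_flow ::
    "('a, 'b) monoid_scheme \<Rightarrow> 'a set \<Rightarrow> ('a \<times> 'a \<Rightarrow> ('a \<times> 'a) list) \<Rightarrow> bool" where
  "bounded_flow G X \<Phi> \<longleftrightarrow> (\<exists>k. \<forall>e\<in>arcs (cayley_graph G X). length (\<Phi> e) \<le> k)"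

definition stackable_over :: "('a, 'b) monoid_scheme \<Rightarrow> 'a set \<Rightarrow> bool" where
  "stackable_over G X \<longleftrightarrow>
     (\<exists>T \<Phi>. maximal_tree G X T \<and> flow_function G X T \<Phi> \<and> bounded_flow G X \<Phi>)"

definition stackable :: "('a, 'b) monoid_scheme \<Rightarrow> bool" where
  "stackable G \<longleftrightarrow> group G \<and> (\<exists>X. inv_closed_gen_set G X \<and> stackable_over G X)"

section \<open>HNN extensions\<close>

definition fin_gen_subgroup :: "'a set \<Rightarrow> ('a, 'b) monoid_scheme \<Rightarrow> bool" where
  "fin_gen_subgroup A H \<longleftrightarrow>
     subgroup A H \<and> (\<exists>S. finite S \<and> S \<subseteq> carrier H \<and> generate H S = A)"

text \<open>The group $\langle H, s \mid s a s^{-1} = \psi(a)\ (a \in A)\rangle$ is built as the set of words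
  over the elements of \<open>H\<close> and the letters $s$, $s^{-1}$, modulo the congruence generated by the
  multiplication table of \<open>H\<close>, the cancellation of $s$ with $s^{-1}$, and the relations
  $s a s^{-1} = \psi(a)$.\<close>

datatype 'a hnn_letter = Base 'a | Stable | Stable_inv

definition hnn_words :: "('a, 'b) monoid_scheme \<Rightarrow> 'a hnn_letter list set" where
  "hnn_words H = lists (Base ` carrier H \<union> {Stable, Stable_inv})"

inductive_set hnn_relators ::
    "('a, 'b) monoid_scheme \<Rightarrow> 'a set \<Rightarrow> ('a \<Rightarrow> 'a) \<Rightarrow> ('a hnn_letter list \<times> 'a hnn_letter list) set"
  for H :: "('a, 'b) monoid_scheme" and A :: "'a set" and \<psi> :: "'a \<Rightarrow> 'a" where
  one: "([Base \<one>\<^bsub>H\<^esub>], []) \<in> hnn_relators H A \<psi>"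
| mult: "\<lbrakk>h \<in> carrier H; k \<in> carrier H\<rbrakk> \<Longrightarrow>
    ([Base h, Base k], [Base (h \<otimes>\<^bsub>H\<^esub> k)]) \<in> hnn_relators H A \<psi>"
| cancel: "([Stable, Stable_inv], []) \<in> hnn_relators H A \<psi>"
| cancel': "([Stable_inv, Stable], []) \<in> hnn_relators H A \<psi>"
| conj: "a \<in> A \<Longrightarrow> ([Stable, Base a, Stable_inv], [Base (\<psi> a)]) \<in> hnn_relators H A \<psi>"

inductive_set hnn_cong ::
    "('a, 'b) monoid_scheme \<Rightarrow> 'a set \<Rightarrow> ('a \<Rightarrow> 'a) \<Rightarrow> ('a hnn_letter list \<times> 'a hnn_letter list) set"
  for H :: "('a, 'b) monoid_scheme" and A :: "'a set" and \<psi> :: "'a \<Rightarrow> 'a" where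
  step: "\<lbrakk>u \<in> hnn_words H; v \<in> hnn_words H; (l, r) \<in> hnn_relators H A \<psi>\<rbrakk> \<Longrightarrow>
    (u @ l @ v, u @ r @ v) \<in> hnn_cong H A \<psi>"
| refl: "w \<in> hnn_words H \<Longrightarrow> (w, w) \<in> hnn_cong H A \<psi>"
| sym: "(w, w') \<in> hnn_cong H A \<psi> \<Longrightarrow> (w', w) \<in> hnn_cong H A \<psi>"
| trans: "\<lbrakk>(w, w') \<in> hnn_cong H A \<psi>; (w', w'') \<in> hnn_cong H A \<psi>\<rbrakk> \<Longrightarrow> (w, w'') \<in> hnn_cong H A \<psi>"

definition hnn_extension ::
    "('a, 'b) monoid_scheme \<Rightarrow> 'a set \<Rightarrow> ('a \<Rightarrow> 'a) \<Rightarrow> 'a hnn_letter list set monoid" where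
  "hnn_extension H A \<psi> =
     \<lparr>carrier = hnn_words H // hnn_cong H A \<psi>,
      monoid.mult = (\<lambda>U V. \<Union>u\<in>U. \<Union>v\<in>V. hnn_cong H A \<psi> `` {u @ v}),
      one = hnn_cong H A \<psi> `` {[]}\<rparr>"

end

theory Submission
  imports Defs
begin

text \<open>
  The generators of the HNN extension \<open>G\<close> are those of \<open>H\<close> together with \<open>s\<close> and \<open>s\<inverse>\<close>.
  Right multiplication on normal forms identifies the Cayley graph of \<open>G\<close> with a union of
  translates of the Cayley graph of \<open>H\<close>, one for each coset \<open>gH\<close>, arranged along the Bass--Serre
  tree. Two adjacent cosets are joined by a strip of parallel \<open>s\<close>-edges indexed by \<open>B\<close> (or, read
  backwards, by \<open>A\<close>). The maximal tree consists of the translated trees and the edge with index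
  \<open>\<one>\<close> of each strip. The flow translates that of \<open>H\<close> inside the cosets; an \<open>s\<close>-edge of index
  \<open>c \<noteq> \<one>\<close> is pushed to the edge of the same strip with index \<open>c d\<close>, where \<open>d\<close> ranges over a
  finite set and is chosen such that \<open>c d\<close> is shorter than \<open>c\<close> in a word length on \<open>B\<close> (or \<open>A\<close>). Since edges
  inside cosets never flow back to \<open>s\<close>-edges, the order is well-founded lexicographically.
\<close>

section \<open>Maximal trees of Cayley graphs\<close>

text \<open>Maximal trees are defined globally, by maximality and absence of circuits, while the
  tree of G has to be assembled from many copies of the tree of H. Parent arcs mediate: they can be
  extracted from any maximal tree, and for G they can be checked vertex by vertex, a well-founded
  order replacing the search for circuits. The detour of an s-edge from g rests on g t = g d t e,
  where t is \<open>\<tau> \<epsilon>\<close> and e is \<open>\<phi> \<epsilon> (inv d)\<close>. It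
  spells d and e over the generators of H; as d ranges over a finite set, its length is bounded.
  Progress is measured over generators of the associated subgroup itself, since that subgroup may be
  distorted in H and lengths over the generators of H need not decrease. Coordinates on G require
  the normal form theorem for HNN extensions. It is obtained by van der Waerden's method: words act
  on the candidate normal forms, both sides of every relator act alike, and evaluating the state
  reached from the trivial one recovers the group element.\<close>

abbreviation edge_target :: "('a, 'b) monoid_scheme \<Rightarrow> 'a \<times> 'a \<Rightarrow> 'a" where
  "edge_target G \<equiv> (\<lambda>(g, a). g \<otimes>\<^bsub>G\<^esub> a)"

definition cayley_sub ::
    "('a, 'b) monoid_scheme \<Rightarrow> 'a set \<Rightarrow> ('a \<times> 'a) set \<Rightarrow> ('a, 'a \<times> 'a) pre_digraph" where
  "cayley_sub G V E = \<lparr>verts = V, arcs = E, tail = fst, head = edge_target G\<rparr>"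

lemma cayley_sub_simps [simp]:
  "verts (cayley_sub G V E) = V" "arcs (cayley_sub G V E) = E"
  "tail (cayley_sub G V E) = fst" "head (cayley_sub G V E) = edge_target G"
  by (simp_all add: cayley_sub_def)

lemma cayley_graph_eq_sub: "cayley_graph G X = cayley_sub G (carrier G) (carrier G \<times> X)"
  by (simp add: cayley_graph_def cayley_sub_def)

text \<open>\<open>P\<close> consists of one arc out of each vertex other than \<open>r\<close>, leading to its parent.\<close>

definition parent_arcs ::
    "('a, 'b) monoid_scheme \<Rightarrow> 'a set \<Rightarrow> 'a \<Rightarrow> 'a set \<Rightarrow> ('a \<times> 'a) set \<Rightarrow> bool" where
  "parent_arcs G X r V P \<longleftrightarrow>
     V \<subseteq> carrier G \<and> r \<in> V \<and> P \<subseteq> V \<times> X \<and> edge_target G ` P \<subseteq> V \<and>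
     fst ` P = V - {r} \<and> inj_on fst P \<and> wf ((\<lambda>e. (edge_target G e, fst e)) ` P)"

definition sym_edges :: "('a, 'b) monoid_scheme \<Rightarrow> ('a \<times> 'a) set \<Rightarrow> ('a \<times> 'a) set" where
  "sym_edges G P = P \<union> rev_edge G ` P"

locale cayley = group G for G (structure) +
  fixes X
  assumes gen_set: "inv_closed_gen_set G X"
begin

lemma X_carrier: "X \<subseteq> carrier G" and X_finite: "finite X"
  and X_inv: "a \<in> X \<Longrightarrow> inv a \<in> X" and one_notin_X: "\<one> \<notin> X"
  and X_generate: "generate G X = carrier G"
  using gen_set by (auto simp: inv_closed_gen_set_def)

lemma X_closed [simp]: "a \<in> X \<Longrightarrow> a \<in> carrier G"
  using X_carrier by auto

lemma rev_edge_simps: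
  assumes "e \<in> carrier G \<times> X"
  shows "rev_edge G e \<in> carrier G \<times> X" "fst (rev_edge G e) = edge_target G e"
    "edge_target G (rev_edge G e) = fst e" "rev_edge G (rev_edge G e) = e"
  using assms by (auto simp: rev_edge_def X_inv m_assoc)

lemma edge_eqI:
  assumes "e \<in> carrier G \<times> X" "e' \<in> carrier G \<times> X"
    and "fst e = fst e'" "edge_target G e = edge_target G e'"
  shows "e = e'"
  using assms by (auto dest: X_closed)

lemma edge_no_loop:
  assumes "e \<in> carrier G \<times> X"
  shows "edge_target G e \<noteq> fst e"
  using assms one_notin_X by (auto dest: X_closed)

lemma sym_edges_rev_closed:
  assumes "P \<subseteq> carrier G \<times> X" "e \<in> sym_edges G P"
  shows "rev_edge G e \<in> sym_edges G P"
  using assms rev_edge_simps(4) by (auto simp: sym_edges_def subset_iff)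

lemma subgraph_cayleyD:
  assumes "subgraph T (cayley_graph G X)"
  shows "T = cayley_sub G (verts T) (arcs T)" "verts T \<subseteq> carrier G" "arcs T \<subseteq> carrier G \<times> X"
    "wf_digraph T" "tail T = fst" "head T = edge_target G"
  using assms by (auto simp: subgraph_def compatible_def cayley_graph_def cayley_sub_def)

lemma wf_digraph_cayley_sub:
  assumes "fst ` E \<subseteq> V" "edge_target G ` E \<subseteq> V"
  shows "wf_digraph (cayley_sub G V E)"
  using assms by unfold_locales auto

lemma cayley_sub_symmetric:
  assumes "E \<subseteq> carrier G \<times> X" "\<And>e. e \<in> E \<Longrightarrow> rev_edge G e \<in> E"
  shows "symmetric (cayley_sub G V E)"
  unfolding symmetric_conv
proof
  fix e assume e: "e \<in> arcs (cayley_sub G V E)"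
  then show "\<exists>e2\<in>arcs (cayley_sub G V E). tail (cayley_sub G V E) e = head (cayley_sub G V E) e2 \<and>
      head (cayley_sub G V E) e = tail (cayley_sub G V E) e2"
    using assms(1) rev_edge_simps(2,3)[of e] by (intro bexI[of _ "rev_edge G e"]) (auto simp: assms(2))
qed

lemma wf_digraph_cayley_graph: "wf_digraph (cayley_graph G X)"
  unfolding cayley_graph_eq_sub by (intro wf_digraph_cayley_sub) auto

text \<open>The library notion of connectedness refers to the symmetric closure; a symmetric digraph
  has the same reachability as its closure, so walks in \<open>T\<close> itself suffice.\<close>

lemma connected_sym_iff:
  assumes "wf_digraph T" "symmetric T"
  shows "Digraph_Component.connected T \<longleftrightarrow>
    verts T \<noteq> {} \<and> (\<forall>u\<in>verts T. \<forall>v\<in>verts T. \<exists>p. pre_digraph.awalk T u p v)"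
proof -
  interpret wf_digraph T by fact
  show ?thesis
    using reachable_mk_symmetric_eq[OF assms(2)]
    by (simp add: Digraph_Component.connected_def strongly_connected_def reachable_awalk)
qed

lemma parent_arcs_subset:
  assumes "parent_arcs G X r V P"
  shows "P \<subseteq> carrier G \<times> X" "sym_edges G P \<subseteq> carrier G \<times> X"
proof -
  show P: "P \<subseteq> carrier G \<times> X"
    using assms by (auto simp: parent_arcs_def)
  show "sym_edges G P \<subseteq> carrier G \<times> X"
    unfolding sym_edges_def using P rev_edge_simps(1) by (intro Un_least image_subsetI) blast+
qed

lemma parent_arcs_wf_digraph:
  assumes P: "parent_arcs G X r V P"
  shows "wf_digraph (cayley_sub G V (sym_edges G P))"
proof (rule wf_digraph_cayley_sub)
  have *: "fst e \<in> V \<and> edge_target G e \<in> V" if "e \<in> P" for e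
    using P that by (auto simp: parent_arcs_def)
  have "fst e \<in> V \<and> edge_target G e \<in> V" if "e \<in> sym_edges G P" for e
    using that unfolding sym_edges_def
  proof
    assume "e \<in> rev_edge G ` P"
    then obtain f where f: "f \<in> P" "e = rev_edge G f" by blast
    then have "f \<in> carrier G \<times> X" using parent_arcs_subset[OF P] by blast
    then show ?thesis using *[OF f(1)] rev_edge_simps(2,3)[of f] f(2) by simp
  qed (rule *)
  then show "fst ` sym_edges G P \<subseteq> V" "edge_target G ` sym_edges G P \<subseteq> V" by blast+
qed

text \<open>On a circuit take a vertex that is the parent of no vertex of the circuit. Both circuit
  edges at it must be its parent arc, up to orientation; as a vertex has only one parent arc, its
  two neighbours coincide, which length at least 3 forbids.\<close>

lemma parent_arcs_acyclic:
  assumes P: "parent_arcs G X r V P"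
  shows "\<not> (\<exists>p. pre_digraph.cycle (cayley_sub G V (sym_edges G P)) p \<and> length p \<ge> 3)"
proof
  let ?T = "cayley_sub G V (sym_edges G P)"
  let ?R = "(\<lambda>e. (edge_target G e, fst e)) ` P"
  assume "\<exists>p. pre_digraph.cycle ?T p \<and> length p \<ge> 3"
  then obtain p u where p: "pre_digraph.awalk ?T u p u" "distinct (tl (pre_digraph.awalk_verts ?T u p))"
    "length p \<ge> 3"
    by (auto simp: pre_digraph.cycle_def)
  have PX: "P \<subseteq> carrier G \<times> X" and inj: "inj_on fst P" and wfR: "wf ?R"
    using P by (auto simp: parent_arcs_def)
  define n where "n = length p"
  define h where "h i = edge_target G (p ! i)" for i
  \<comment> \<open>Cyclic predecessor: the edge \<open>p ! i\<close> runs from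
    \<open>h (pr i)\<close> to \<open>h i\<close>.\<close>
  define pr where "pr i = (if i = 0 then n - 1 else i - 1)" for i
  have n: "n \<ge> 3" using p n_def by simp
  have ne: "p \<noteq> []" using p(3) by auto
  have arcs: "set p \<subseteq> sym_edges G P" and cas: "pre_digraph.cas ?T u p u"
    using p(1) by (auto simp: pre_digraph.awalk_def)
  have v1: "pre_digraph.awalk_verts ?T u p = fst (hd p) # map (edge_target G) p"
    using pre_digraph.awalk_verts_conv'[OF cas] ne by simp
  have v2: "pre_digraph.awalk_verts ?T u p = map fst p @ [edge_target G (last p)]"
    using pre_digraph.awalk_verts_conv[of ?T u p] ne by simp
  have dist: "h i \<noteq> h j" if "i < n" "j < n" "i \<noteq> j" for i j
    using p(2) that unfolding v1 by (simp add: distinct_conv_nth h_def n_def)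
  note wfT = parent_arcs_wf_digraph[OF P]
  have last: "edge_target G (last p) = u"
    using wf_digraph.awlast_if_cas[OF wfT cas] unfolding v2 by simp
  have step: "fst (p ! i) = h (pr i)" if "i < n" for i
  proof (cases i)
    case 0
    then have "fst (p ! i) = u"
      using cas ne by (cases p) (auto simp: pre_digraph.cas.simps)
    then show ?thesis
      using 0 last ne by (simp add: h_def pr_def n_def last_conv_nth)
  next
    case (Suc j)
    have "(map fst p @ [edge_target G (last p)]) ! i = (fst (hd p) # map (edge_target G) p) ! i"
      using v1 v2 by simp
    then show ?thesis
      using that Suc by (simp add: nth_append n_def h_def pr_def)
  qed
  have edge: "p ! i \<in> P \<and> (h i, h (pr i)) \<in> ?R \<or>
      (\<exists>e\<in>P. fst e = h i \<and> edge_target G e = h (pr i))" if i: "i < n" for i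
  proof -
    have "p ! i \<in> sym_edges G P"
      using arcs i by (auto simp: n_def)
    then consider "p ! i \<in> P" | e where "e \<in> P" "p ! i = rev_edge G e"
      by (auto simp: sym_edges_def)
    then show ?thesis
    proof cases
      case 1
      then show ?thesis using step[OF i] by (force simp: h_def)
    next
      case 2
      then have "e \<in> carrier G \<times> X" using PX by auto
      then show ?thesis
        using 2 step[OF i] rev_edge_simps(2,3)[of e] by (auto simp: h_def)
    qed
  qed
  \<comment> \<open>\<open>?R\<close> relates parent to child. Restricted to the finite circuit it
    is acyclic, so its converse is well-founded there and some vertex has no child on the
    circuit.\<close>
  obtain i where i: "i < n" and max: "\<And>j. j < n \<Longrightarrow> (h i, h j) \<notin> ?R"
  proof -
    let ?S = "h ` {..<n}"
    have "acyclic (?R \<inter> ?S \<times> ?S)"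
      using wf_acyclic[OF wfR] by (rule acyclic_subset) auto
    moreover have "finite (?R \<inter> ?S \<times> ?S)"
      by (rule finite_subset[of _ "?S \<times> ?S"]) auto
    ultimately have wf: "wf ((?R \<inter> ?S \<times> ?S)\<inverse>)"
      by (rule finite_acyclic_wf_converse[rotated])
    have "h 0 \<in> ?S" using n by simp
    then obtain z where z: "z \<in> ?S" "\<And>y. (y, z) \<in> (?R \<inter> ?S \<times> ?S)\<inverse> \<Longrightarrow> y \<notin> ?S"
      using wfE_min[OF wf] by metis
    then obtain i where "i < n" "z = h i" by blast
    moreover have "(h i, h j) \<notin> ?R" if "j < n" for j
    proof
      assume "(h i, h j) \<in> ?R"
      then have "(h j, z) \<in> (?R \<inter> ?S \<times> ?S)\<inverse>"
        unfolding \<open>z = h i\<close> using that \<open>i < n\<close> by blast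
      then show False using z(2) that by blast
    qed
    ultimately show ?thesis using that by blast
  qed
  \<comment> \<open>The cyclic successor of \<open>i\<close>. It differs from \<open>pr i\<close>
    because \<open>n \<ge> 3\<close>; for \<open>n = 2\<close> an edge traversed back and forth
    would survive.\<close>
  define j where "j = (if i = n - 1 then 0 else Suc i)"
  have j: "j < n" "pr j = i" "j \<noteq> pr i" "pr i < n"
    using i n by (auto simp: j_def pr_def)
  obtain e where e: "e \<in> P" "fst e = h i" "edge_target G e = h (pr i)"
    using edge[OF i] max[OF j(4)] by blast
  have "(h i, h j) \<in> ?R" if "e \<in> P" "fst e = h j" "edge_target G e = h i" for e
    using that by (intro image_eqI[of _ _ e]) auto
  then have "p ! j \<in> P"
    using edge[OF j(1)] max[OF j(1)] unfolding j(2) by blast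
  moreover have "fst (p ! j) = h i"
    using step[OF j(1)] j(2) by simp
  ultimately have "p ! j = e"
    using inj e by (metis inj_onD)
  then have "h j = h (pr i)"
    using e by (simp add: h_def)
  then show False
    using dist j by blast
qed

text \<open>Connectedness follows by induction along the parent order: each vertex is joined to its
  parent in both directions, and hence to \<open>r\<close>.\<close>

lemma parent_arcs_undirected_tree:
  assumes P: "parent_arcs G X r V P"
  shows "undirected_tree G (cayley_sub G V (sym_edges G P))" (is "undirected_tree G ?T")
proof -
  interpret T: wf_digraph ?T by (rule parent_arcs_wf_digraph[OF P])
  let ?R = "(\<lambda>e. (edge_target G e, fst e)) ` P"
  note PX = parent_arcs_subset[OF P]
  have rev: "rev_edge G e \<in> sym_edges G P" if "e \<in> sym_edges G P" for e
    using sym_edges_rev_closed PX that by blast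
  have reach: "(\<exists>p. T.awalk v p r) \<and> (\<exists>p. T.awalk r p v)" if "v \<in> V" for v
  proof -
    have "wf ?R" using P by (simp add: parent_arcs_def)
    then show ?thesis using that
    proof (induction v rule: wf_induct_rule)
      case (less v)
      show ?case
      proof (cases "v = r")
        case True
        then show ?thesis using less.prems by (metis T.awalk_Nil_iff cayley_sub_simps(1))
      next
        case False
        then have "v \<in> fst ` P" using P less.prems by (auto simp: parent_arcs_def)
        then obtain e where e: "e \<in> P" "fst e = v" by auto
        then have ec: "e \<in> carrier G \<times> X" and "edge_target G e \<in> V"
          using P PX by (auto simp: parent_arcs_def)
        moreover have "(edge_target G e, v) \<in> ?R" using e by force
        ultimately obtain p q where pq: "T.awalk (edge_target G e) p r" "T.awalk r q (edge_target G e)"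
          using less.IH by blast
        have arcs: "e \<in> sym_edges G P" "rev_edge G e \<in> sym_edges G P"
          using e by (auto simp: sym_edges_def)
        then have "T.awalk v (e # p) r"
          using e pq(1) less.prems by (simp add: T.awalk_Cons_iff)
        moreover have "T.awalk r (q @ [rev_edge G e]) v"
          using e pq(2) less.prems rev_edge_simps(2,3)[OF ec] \<open>edge_target G e \<in> V\<close>
          arcs by (simp add: T.awalk_Cons_iff T.awalk_Nil_iff)
        ultimately show ?thesis by blast
      qed
    qed
  qed
  have "symmetric ?T" using PX rev by (intro cayley_sub_symmetric) auto
  moreover have "\<exists>p. T.awalk u p v" if "u \<in> V" "v \<in> V" for u v
    using reach that T.awalk_appendI by meson
  ultimately have "Digraph_Component.connected ?T"
    using P connected_sym_iff[OF T.wf_digraph_axioms] by (auto simp: parent_arcs_def)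
  then show ?thesis
    using parent_arcs_acyclic[OF P] rev by (simp add: undirected_tree_def)
qed

section \<open>From a given maximal tree to parent arcs\<close>

lemma undirected_tree_awalk:
  assumes "subgraph T (cayley_graph G X)" "undirected_tree G T" "u \<in> verts T" "v \<in> verts T"
  obtains p where "pre_digraph.awalk T u p v"
proof -
  note T = subgraph_cayleyD[OF assms(1)]
  have "symmetric (cayley_sub G (verts T) (arcs T))"
    using assms(2) T by (intro cayley_sub_symmetric) (auto simp: undirected_tree_def)
  then have "symmetric T" using T by simp
  then show ?thesis
    using connected_sym_iff[OF T(4)] assms that unfolding undirected_tree_def by metis
qed

text \<open>An arc of \<open>T'\<close> missing from \<open>T\<close> would close up with a simple
  path of \<open>T\<close> between its ends to a circuit in \<open>T'\<close>. This serves twice: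
  for the maximality of spanning trees, and to see that extracted parent arcs exhaust their
  tree.\<close>

lemma spanning_subtree_eq:
  assumes sub: "subgraph T T'" "subgraph T' (cayley_graph G X)" and V: "verts T = verts T'"
    and tree: "undirected_tree G T" "undirected_tree G T'"
  shows "T = T'"
proof -
  have subT: "subgraph T (cayley_graph G X)"
    using sub by (auto simp: subgraph_def compatible_def)
  note T = subgraph_cayleyD[OF subT] and T' = subgraph_cayleyD[OF sub(2)]
  interpret T: wf_digraph T by (rule T(4))
  interpret T': wf_digraph T' by (rule T'(4))
  have "e \<in> arcs T" if e: "e \<in> arcs T'" for e
  proof (rule ccontr)
    assume eT: "e \<notin> arcs T"
    have ec: "e \<in> carrier G \<times> X" using e T' by auto
    have ends: "fst e \<in> verts T" "edge_target G e \<in> verts T"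
      using T'.wellformed[OF e] V T' by auto
    obtain q where "T.awalk (edge_target G e) q (fst e)"
      using undirected_tree_awalk[OF subT tree(1) ends(2,1)] .
    then obtain p where p: "T.apath (edge_target G e) p (fst e)"
      using T.reachable_awalk T.reachable_apath by blast
    then have w: "T.awalk (edge_target G e) p (fst e)" by (simp add: T.apath_def)
    have w': "T'.awalk (edge_target G e) p (fst e)"
      using T'.subgraph_awalk_imp_awalk[OF w] sub by simp
    have vs: "T'.awalk_verts = T.awalk_verts"
      using sub compatible_awalk_verts by (metis subgraph_def)
    have "T'.cycle (e # p)"
      unfolding T'.cycle_def
      using w' p e ends V T' by (intro exI[of _ "fst e"]) (simp add: T'.awalk_Cons_iff T.apath_def flip: vs)
    \<comment> \<open>Length 0 would make \<open>e\<close> a loop; length 1 would make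
      \<open>p\<close> the reverse of \<open>e\<close>, and \<open>T\<close>, being closed under
      reversal, would contain \<open>e\<close>.\<close>
    moreover have "length p \<ge> 2"
    proof (rule ccontr)
      assume "\<not> length p \<ge> 2"
      then consider "p = []" | f where "p = [f]"
        by (cases p rule: remdups_adj.cases) auto
      then show False
      proof cases
        case 1
        then show False using w edge_no_loop[OF ec] by (simp add: T.awalk_Nil_iff)
      next
        case 2
        then have f: "f \<in> arcs T" "fst f = edge_target G e" "edge_target G f = fst e"
          using w T by (auto simp: T.awalk_Cons_iff T.awalk_Nil_iff)
        have fc: "f \<in> carrier G \<times> X" using f T by auto
        have "rev_edge G f = e"
          using rev_edge_simps[OF fc] f ec by (intro edge_eqI) auto
        then show False using tree(1) f eT by (auto simp: undirected_tree_def)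
      qed
    qed
    ultimately have "\<exists>p. T'.cycle p \<and> length p \<ge> 3"
      by (intro exI[of _ "e # p"]) simp
    then show False using tree(2) by (simp add: undirected_tree_def)
  qed
  then have "arcs T = arcs T'" using sub by (auto simp: subgraph_def)
  then show ?thesis using T(1) T'(1) V by metis
qed

lemma parent_arcs_maximal_tree:
  assumes P: "parent_arcs G X r (carrier G) P"
  shows "maximal_tree G X (cayley_sub G (carrier G) (sym_edges G P))" (is "maximal_tree G X ?T")
proof -
  have sub: "subgraph ?T (cayley_graph G X)"
    using parent_arcs_wf_digraph[OF P] parent_arcs_subset[OF P] wf_digraph_cayley_graph
    by (auto simp: subgraph_def compatible_def cayley_graph_eq_sub)
  have "T' = ?T" if T': "subgraph ?T T'" "subgraph T' (cayley_graph G X)" "undirected_tree G T'" for T'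
  proof -
    have "verts ?T = verts T'"
      using T'(1) subgraph_cayleyD(2)[OF T'(2)] by (auto simp: subgraph_def)
    then show ?thesis
      using spanning_subtree_eq[OF T'(1,2)] T'(3) parent_arcs_undirected_tree[OF P] by metis
  qed
  then show ?thesis
    using sub parent_arcs_undirected_tree[OF P]
    by (auto simp: maximal_tree_def pre_digraph.max_subgraph_def)
qed

text \<open>Breadth-first search: the parent arc of a vertex is the first arc of a shortest walk to the
  root.\<close>

lemma undirected_tree_parent_arcs:
  assumes sub: "subgraph T (cayley_graph G X)" and tree: "undirected_tree G T" and r: "r \<in> verts T"
  obtains P where "parent_arcs G X r (verts T) P" "T = cayley_sub G (verts T) (sym_edges G P)"
proof -
  note T = subgraph_cayleyD[OF sub]
  interpret T: wf_digraph T by (rule T(4))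
  define sw where "sw v = (ARG_MIN length p. T.awalk v p r)" for v
  have sw: "T.awalk v (sw v) r" if v: "v \<in> verts T" for v
  proof -
    obtain p where "T.awalk v p r" using undirected_tree_awalk[OF sub tree v r] .
    then show ?thesis unfolding sw_def by (rule arg_min_natI)
  qed
  have sw_le: "length (sw v) \<le> length p" if "T.awalk v p r" for v p
    using that unfolding sw_def by (rule arg_min_nat_le)
  define P where "P = (\<lambda>v. hd (sw v)) ` (verts T - {r})"
  have hd: "hd (sw v) \<in> arcs T" "fst (hd (sw v)) = v" "edge_target G (hd (sw v)) \<in> verts T"
    "length (sw (edge_target G (hd (sw v)))) < length (sw v)" if "v \<in> verts T - {r}" for v
  proof -
    have "sw v \<noteq> []" using sw[of v] that by (auto simp: T.awalk_Nil_iff)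
    then obtain e p where ep: "sw v = e # p" by (cases "sw v") auto
    then have a: "e \<in> arcs T" "fst e = v" "T.awalk (edge_target G e) p r"
      using sw[of v] that T by (auto simp: T.awalk_Cons_iff)
    then show "hd (sw v) \<in> arcs T" "fst (hd (sw v)) = v" "edge_target G (hd (sw v)) \<in> verts T"
      "length (sw (edge_target G (hd (sw v)))) < length (sw v)"
      using ep sw_le[OF a(3)] T.awalk_hd_in_verts by auto
  qed
  have "(edge_target G e, fst e) \<in> measure (\<lambda>v. length (sw v))" if "e \<in> P" for e
    using that hd unfolding P_def by (elim imageE) (simp add: in_measure)
  then have "wf ((\<lambda>e. (edge_target G e, fst e)) ` P)"
    by (intro wf_subset[OF wf_measure]) blast
  moreover have "P \<subseteq> verts T \<times> X" "edge_target G ` P \<subseteq> verts T"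
    using hd T by (fastforce simp: P_def)+
  moreover have "fst ` P = verts T - {r}" "inj_on fst P"
    using hd by (auto simp: P_def image_image inj_on_def)
  ultimately have P: "parent_arcs G X r (verts T) P"
    using r T by (simp add: parent_arcs_def)
  have "P \<subseteq> arcs T"
    unfolding P_def using hd(1) by blast
  then have "sym_edges G P \<subseteq> arcs T"
    using tree unfolding sym_edges_def undirected_tree_def by blast
  \<comment> \<open>The parent arcs already form a spanning tree inside \<open>T\<close>, so no
    further arc of \<open>T\<close> can remain.\<close>
  then have "subgraph (cayley_sub G (verts T) (sym_edges G P)) T"
    using parent_arcs_wf_digraph[OF P] T by (simp add: subgraph_def compatible_def)
  then have "cayley_sub G (verts T) (sym_edges G P) = T"
    using parent_arcs_undirected_tree[OF P] tree sub by (intro spanning_subtree_eq) auto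
  then show ?thesis using that P by simp
qed

text \<open>Connectedness of the Cayley graph in contrapositive form: a nonempty proper set of
  vertices has an edge leaving it.\<close>

lemma right_mult_closed_eq_carrier:
  assumes "r \<in> V" "V \<subseteq> carrier G" "\<And>v a. v \<in> V \<Longrightarrow> a \<in> X \<Longrightarrow> v \<otimes> a \<in> V"
  shows "V = carrier G"
proof -
  have gen: "\<forall>v\<in>V. v \<otimes> h \<in> V" if "h \<in> generate G X" for h
    using that
  proof (induction rule: generate.induct)
    case (eng h1 h2)
    then have "h1 \<in> carrier G" "h2 \<in> carrier G" using X_generate by auto
    then show ?case using eng assms(2) by (metis m_assoc subsetD)
  qed (use assms X_inv in auto)
  have "g \<in> V" if "g \<in> carrier G" for g
  proof -
    have "r \<otimes> (inv r \<otimes> g) \<in> V" using gen assms that X_generate by blast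
    then show ?thesis using assms that by (auto simp: m_assoc[symmetric] subset_iff)
  qed
  then show ?thesis using assms by auto
qed

text \<open>Otherwise some edge of the Cayley graph leaves the tree, and attaching its far end as a
  leaf gives a strictly larger tree.\<close>

lemma maximal_tree_spanning:
  assumes max: "maximal_tree G X T"
  shows "verts T = carrier G"
proof (rule ccontr)
  assume neq: "verts T \<noteq> carrier G"
  have sub: "subgraph T (cayley_graph G X)" and tree: "undirected_tree G T"
    using max by (auto simp: maximal_tree_def pre_digraph.max_subgraph_def)
  note T = subgraph_cayleyD[OF sub]
  obtain r where r: "r \<in> verts T"
    using tree by (auto simp: undirected_tree_def Digraph_Component.connected_def strongly_connected_def)
  obtain P where P: "parent_arcs G X r (verts T) P" "T = cayley_sub G (verts T) (sym_edges G P)"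
    using undirected_tree_parent_arcs[OF sub tree r] .
  obtain v a where va: "v \<in> verts T" "a \<in> X" "v \<otimes> a \<notin> verts T"
    using right_mult_closed_eq_carrier[OF r T(2)] neq by blast
  have v: "v \<in> carrier G" using va T(2) by auto
  let ?e = "(v \<otimes> a, inv a)" and ?V = "insert (v \<otimes> a) (verts T)"
  let ?R = "(\<lambda>e. (edge_target G e, fst e)) ` P"
  have tgt: "v \<otimes> a \<otimes> inv a = v" using va v by (simp add: m_assoc)
  have "edge_target G ` P \<subseteq> verts T"
    using P(1) by (simp add: parent_arcs_def)
  then have no_out: "(v \<otimes> a, y) \<notin> ?R" for y
    using va(3) by blast
  \<comment> \<open>Adding a pair keeps a relation well-founded unless it closes a loop; the new
    vertex is nobody's parent in \<open>P\<close>, so no loop arises.\<close>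
  have "(v \<otimes> a, v) \<notin> ?R\<^sup>*"
  proof
    assume "(v \<otimes> a, v) \<in> ?R\<^sup>*"
    then show False
    proof (cases rule: converse_rtranclE)
      case base
      then show False using va by metis
    next
      case (step y)
      then show False using no_out by blast
    qed
  qed
  moreover have "wf ?R" using P(1) by (simp add: parent_arcs_def)
  ultimately have "wf (insert (v, v \<otimes> a) ?R)"
    by simp
  then have P': "parent_arcs G X r ?V (insert ?e P)"
    using P(1) va v tgt X_inv[OF va(2)] r
    by (simp add: parent_arcs_def insert_Diff_if inj_on_insert) blast
  let ?T = "cayley_sub G ?V (sym_edges G (insert ?e P))"
  have "undirected_tree G ?T" by (rule parent_arcs_undirected_tree[OF P'])
  moreover have "subgraph ?T (cayley_graph G X)"
    using parent_arcs_wf_digraph[OF P'] parent_arcs_subset[OF P'] v va(2) T(2) wf_digraph_cayley_graph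
    by (simp add: subgraph_def compatible_def cayley_graph_eq_sub)
  moreover have "subgraph T ?T"
    by (subst P(2)) (use parent_arcs_wf_digraph[OF P'] parent_arcs_wf_digraph[OF P(1)] in
      \<open>simp add: subgraph_def compatible_def sym_edges_def subset_insertI le_supI1 le_supI2\<close>,
       blast)
  moreover have "?T \<noteq> T" using va by (metis cayley_sub_simps(1) insertI1)
  ultimately show False
    using max unfolding maximal_tree_def pre_digraph.max_subgraph_def by blast
qed

lemma maximal_treeE:
  assumes max: "maximal_tree G X T" and r: "r \<in> carrier G"
  obtains P where "parent_arcs G X r (carrier G) P" "T = cayley_sub G (carrier G) (sym_edges G P)"
proof -
  have "subgraph T (cayley_graph G X)" "undirected_tree G T"
    using max by (auto simp: maximal_tree_def pre_digraph.max_subgraph_def)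
  then show ?thesis
    using undirected_tree_parent_arcs[of T r] r that maximal_tree_spanning[OF max] by metis
qed

end

section \<open>Words and coset representatives\<close>

definition word_prod :: "('a, 'b) monoid_scheme \<Rightarrow> 'a list \<Rightarrow> 'a" where
  "word_prod G w = foldr (\<otimes>\<^bsub>G\<^esub>) w \<one>\<^bsub>G\<^esub>"

lemma word_prod_simps [simp]:
  "word_prod G [] = \<one>\<^bsub>G\<^esub>" "word_prod G (a # w) = a \<otimes>\<^bsub>G\<^esub> word_prod G w"
  by (simp_all add: word_prod_def)

fun word_path :: "('a, 'b) monoid_scheme \<Rightarrow> 'a \<Rightarrow> 'a list \<Rightarrow> ('a \<times> 'a) list" where
  "word_path G g [] = []"
| "word_path G g (a # w) = (g, a) # word_path G (g \<otimes>\<^bsub>G\<^esub> a) w"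

lemma length_word_path [simp]: "length (word_path G g w) = length w"
  by (induction w arbitrary: g) auto

lemma snd_word_path: "e \<in> set (word_path G g w) \<Longrightarrow> snd e \<in> set w"
  by (induction w arbitrary: g) auto

context group
begin

lemma word_prod_closed [simp]: "set w \<subseteq> carrier G \<Longrightarrow> word_prod G w \<in> carrier G"
  by (induction w) auto

lemma word_prod_append:
  "set v \<subseteq> carrier G \<Longrightarrow> set w \<subseteq> carrier G \<Longrightarrow>
    word_prod G (v @ w) = word_prod G v \<otimes> word_prod G w"
  by (induction v) (auto simp: m_assoc)

lemma generate_imp_word:
  assumes S: "S \<subseteq> carrier G" "\<And>s. s \<in> S \<Longrightarrow> inv s \<in> S" and h: "h \<in> generate G S"
  shows "\<exists>w. set w \<subseteq> S \<and> word_prod G w = h"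
  using h
proof (induction rule: generate.induct)
  case one
  then show ?case by (intro exI[of _ "[]"]) simp
next
  case (incl h)
  then show ?case using S by (intro exI[of _ "[h]"]) auto
next
  case (inv h)
  then show ?case using S by (intro exI[of _ "[inv h]"]) auto
next
  case (eng h1 h2)
  then obtain v w where "set v \<subseteq> S" "word_prod G v = h1" "set w \<subseteq> S" "word_prod G w = h2"
    by auto
  then show ?case using S(1) by (intro exI[of _ "v @ w"]) (auto simp: word_prod_append)
qed

text \<open>\<open>l\<close> is word length over \<open>S\<close> and its inverses, and
  \<open>s\<close> is the inverse of the last letter of a shortest word for \<open>c\<close>.
  Outside \<open>generate G S\<close> the value of \<open>l\<close> carries no meaning.\<close>

lemma generate_word_length:
  assumes "finite S" "S \<subseteq> carrier G"
  obtains S' :: "'a set" and l :: "'a \<Rightarrow> nat" where "finite S'" "S' \<subseteq> generate G S"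
    "\<And>c. c \<in> generate G S \<Longrightarrow> c \<noteq> \<one> \<Longrightarrow> \<exists>s\<in>S'. l (c \<otimes> s) < l c"
proof -
  define S' where "S' = S \<union> (\<lambda>s. inv s) ` S"
  define l where "l c = (LEAST n. \<exists>w. set w \<subseteq> S' \<and> word_prod G w = c \<and> length w = n)" for c
  have S': "finite S'" "S' \<subseteq> carrier G" and inv_S': "\<And>s. s \<in> S' \<Longrightarrow> inv s \<in> S'"
    using assms by (auto simp: S'_def)
  have S'_gen: "S' \<subseteq> generate G S"
    by (auto simp: S'_def intro: generate.intros)
  have l_le: "l (word_prod G w) \<le> length w" if "set w \<subseteq> S'" for w
    unfolding l_def using that by (intro Least_le) auto
  have "\<exists>s\<in>S'. l (c \<otimes> s) < l c" if c: "c \<in> generate G S" "c \<noteq> \<one>" for c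
  proof -
    have "c \<in> generate G S'"
      using c(1) mono_generate[of S S'] by (auto simp: S'_def)
    then have "\<exists>n w. set w \<subseteq> S' \<and> word_prod G w = c \<and> length w = n"
      using generate_imp_word[OF S'(2) inv_S'] by blast
    then have "\<exists>w. set w \<subseteq> S' \<and> word_prod G w = c \<and> length w = l c"
      unfolding l_def by (rule LeastI_ex)
    then obtain w where w: "set w \<subseteq> S'" "word_prod G w = c" "length w = l c" by blast
    with c(2) obtain v s where vs: "w = v @ [s]" by (cases w rule: rev_cases) auto
    then have sv: "s \<in> carrier G" "set v \<subseteq> carrier G" "s \<in> S'" using w(1) S' by auto
    then have "c \<otimes> inv s = word_prod G v"
      unfolding w(2)[symmetric] vs using sv by (simp add: word_prod_append m_assoc)
    then have "l (c \<otimes> inv s) < l c"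
      using l_le[of v] w vs by simp
    then show ?thesis using inv_S' sv by blast
  qed
  then show ?thesis using that S' S'_gen by blast
qed

text \<open>A representative of the coset h C. Choosing from the coset as a set makes the result
  depend on the coset alone, and \<open>C\<close> itself receives \<open>\<one>\<close>, so that for
  a subgroup the value \<open>\<one>\<close> detects membership.\<close>

definition left_rep :: "'a set \<Rightarrow> 'a \<Rightarrow> 'a" where
  "left_rep C h = (if h \<in> C then \<one> else SOME r. r \<in> (\<lambda>c. h \<otimes> c) ` C)"

lemma left_rep_one: "h \<in> C \<Longrightarrow> left_rep C h = \<one>"
  by (simp add: left_rep_def)

lemma left_rep_eq:
  assumes C: "subgroup C G" and h: "h \<in> carrier G"
  shows "\<exists>c\<in>C. left_rep C h = h \<otimes> c"
proof (cases "h \<in> C")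
  case True
  then show ?thesis
    using h subgroup.m_inv_closed[OF C] by (intro bexI[of _ "inv h"]) (auto simp: left_rep_def)
next
  case False
  have "(SOME r. r \<in> (\<lambda>c. h \<otimes> c) ` C) \<in> (\<lambda>c. h \<otimes> c) ` C"
    unfolding some_in_eq using subgroup.one_closed[OF C] by blast
  then show ?thesis using False by (auto simp: left_rep_def)
qed

lemma left_rep_closed [simp]:
  assumes "subgroup C G" "h \<in> carrier G"
  shows "left_rep C h \<in> carrier G"
  using left_rep_eq[OF assms] assms subgroup.mem_carrier[OF assms(1)] by auto

lemma inv_left_rep_mult:
  assumes C: "subgroup C G" and h: "h \<in> carrier G"
  shows "inv (left_rep C h) \<otimes> h \<in> C"
proof -
  obtain c where c: "c \<in> C" "left_rep C h = h \<otimes> c" using left_rep_eq[OF assms] by blast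
  then have "inv (left_rep C h) \<otimes> h = inv c"
    using subgroup.mem_carrier[OF C] h by (simp add: inv_mult_group m_assoc)
  then show ?thesis using c subgroup.m_inv_closed[OF C] by simp
qed

lemma left_rep_mult:
  assumes C: "subgroup C G" and h: "h \<in> carrier G" and c: "c \<in> C"
  shows "left_rep C (h \<otimes> c) = left_rep C h"
proof -
  interpret C: subgroup C G by (rule C)
  have hc: "h \<otimes> c \<otimes> inv c = h" using h c by (simp add: m_assoc)
  have "h \<otimes> c \<in> C \<longleftrightarrow> h \<in> C"
    using c hc C.m_closed C.m_inv_closed by metis
  moreover have "(\<lambda>d. h \<otimes> c \<otimes> d) ` C = (\<lambda>d. h \<otimes> d) ` C"
  proof (intro equalityI subsetI)
    fix x assume "x \<in> (\<lambda>d. h \<otimes> c \<otimes> d) ` C"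
    then obtain d where "d \<in> C" "x = h \<otimes> (c \<otimes> d)" using h c by (auto simp: m_assoc)
    then show "x \<in> (\<lambda>d. h \<otimes> d) ` C" using c by blast
  next
    fix x assume "x \<in> (\<lambda>d. h \<otimes> d) ` C"
    then obtain d where d: "d \<in> C" "x = h \<otimes> d" by blast
    then have "x = h \<otimes> c \<otimes> (inv c \<otimes> d)" using h c hc by (simp add: m_assoc[symmetric])
    then show "x \<in> (\<lambda>d. h \<otimes> c \<otimes> d) ` C" using c d by blast
  qed
  ultimately show ?thesis by (simp add: left_rep_def)
qed

lemma left_rep_idem:
  assumes "subgroup C G" "h \<in> carrier G"
  shows "left_rep C (left_rep C h) = left_rep C h"
  using left_rep_eq[OF assms] left_rep_mult[OF assms] by metis

end

context cayley
begin

lemma word_path_awalk: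
  assumes "g \<in> carrier G" "set w \<subseteq> X"
  shows "pre_digraph.awalk (cayley_graph G X) g (word_path G g w) (g \<otimes> word_prod G w)"
proof -
  interpret wf_digraph "cayley_graph G X" by (rule wf_digraph_cayley_graph)
  show ?thesis
    using assms
  proof (induction w arbitrary: g)
    case Nil
    then show ?case by (simp add: awalk_Nil_iff) (simp add: cayley_graph_eq_sub)
  next
    case (Cons a w)
    then have "set w \<subseteq> carrier G" using X_carrier by auto
    then show ?case
      using Cons.prems Cons.IH[of "g \<otimes> a"]
      by (simp add: awalk_Cons_iff m_assoc) (simp add: cayley_graph_eq_sub)
  qed
qed

end

section \<open>The action on normal forms\<close>

text \<open>The Boolean is the exponent of the stable letter. Indexing both subgroups by it makes
  the two directions of crossing instances of one statement.\<close>

locale hnn_action = group H for H (structure) +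
  fixes C :: "bool \<Rightarrow> 'a set" and \<phi> :: "bool \<Rightarrow> 'a \<Rightarrow> 'a"
  assumes C_subgroup: "subgroup (C \<epsilon>) H"
    and \<phi>_closed: "c \<in> C \<epsilon> \<Longrightarrow> \<phi> \<epsilon> c \<in> C (\<not> \<epsilon>)"
    and \<phi>_mult: "c \<in> C \<epsilon> \<Longrightarrow> d \<in> C \<epsilon> \<Longrightarrow> \<phi> \<epsilon> (c \<otimes> d) = \<phi> \<epsilon> c \<otimes> \<phi> \<epsilon> d"
    and \<phi>_inverse: "c \<in> C \<epsilon> \<Longrightarrow> \<phi> (\<not> \<epsilon>) (\<phi> \<epsilon> c) = c"
begin

text \<open>The state \<open>([(\<epsilon>\<^sub>k, r\<^sub>k), \<dots>, (\<epsilon>\<^sub>1, r\<^sub>1)], h)\<close> stands for the normal form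
  \<open>r\<^sub>1 \<tau>(\<epsilon>\<^sub>1) \<dots> r\<^sub>k \<tau>(\<epsilon>\<^sub>k) h\<close>, where \<open>\<tau>(True) = s\<close>, \<open>\<tau>(False) = s\<inverse>\<close> and \<open>c \<tau>(\<epsilon>) = \<tau>(\<epsilon>) \<phi>(\<epsilon>, c)\<close> for
  \<open>c \<in> C(\<epsilon>)\<close>; \<open>act \<epsilon>\<close> is right multiplication by \<open>\<tau>(\<epsilon>)\<close>.\<close>

definition act :: "bool \<Rightarrow> (bool \<times> 'a) list \<times> 'a \<Rightarrow> (bool \<times> 'a) list \<times> 'a" where
  "act \<epsilon> = (\<lambda>(n, h).
     let r = left_rep (C \<epsilon>) h; c = \<phi> \<epsilon> (inv r \<otimes> h)
     in if r = \<one> \<and> n \<noteq> [] \<and> fst (hd n) = (\<not> \<epsilon>) then (tl n, snd (hd n) \<otimes> c) else ((\<epsilon>, r) # n, c))"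

text \<open>The head of the list is the last stable letter. The final clause excludes the cancelling
  factor \<open>\<tau>(\<not> \<epsilon>) \<one> \<tau>(\<epsilon>)\<close>; other pinches cannot
  occur, because a chosen representative lying in \<open>C \<epsilon>\<close> is
  \<open>\<one>\<close>.\<close>

fun reduced :: "(bool \<times> 'a) list \<Rightarrow> bool" where
  "reduced [] \<longleftrightarrow> True"
| "reduced ((\<epsilon>, r) # n) \<longleftrightarrow> r \<in> carrier H \<and> left_rep (C \<epsilon>) r = r \<and> reduced n \<and>
     \<not> (r = \<one> \<and> n \<noteq> [] \<and> fst (hd n) = (\<not> \<epsilon>))"

definition states :: "((bool \<times> 'a) list \<times> 'a) set" where
  "states = {(n, h). reduced n \<and> h \<in> carrier H}"

lemma C_carrier: "c \<in> C \<epsilon> \<Longrightarrow> c \<in> carrier H"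
  using C_subgroup by (rule subgroup.mem_carrier)

lemma \<phi>_carrier: "c \<in> C \<epsilon> \<Longrightarrow> \<phi> \<epsilon> c \<in> carrier H"
  using \<phi>_closed C_carrier by blast

lemma C_one [simp]: "\<one> \<in> C \<epsilon>"
  using C_subgroup by (rule subgroup.one_closed)

lemma \<phi>_one [simp]: "\<phi> \<epsilon> \<one> = \<one>"
proof -
  have "\<phi> \<epsilon> \<one> \<otimes> \<phi> \<epsilon> \<one> = \<phi> \<epsilon> \<one>"
    using \<phi>_mult[of \<one> \<epsilon> \<one>] by simp
  then show ?thesis
    using \<phi>_carrier[OF C_one] by (simp add: l_cancel_one)
qed

text \<open>The component of \<open>h\<close> in \<open>C \<epsilon>\<close>. For a
  \<open>\<tau> \<epsilon>\<close>-edge starting at base part \<open>h\<close> it is the index of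
  the edge in its strip.\<close>

definition left_part :: "bool \<Rightarrow> 'a \<Rightarrow> 'a" where
  "left_part \<epsilon> h = inv (left_rep (C \<epsilon>) h) \<otimes> h"

lemma left_part_closed: "h \<in> carrier H \<Longrightarrow> left_part \<epsilon> h \<in> C \<epsilon>"
  unfolding left_part_def by (rule inv_left_rep_mult[OF C_subgroup])

lemma left_rep_left_part: "h \<in> carrier H \<Longrightarrow> left_rep (C \<epsilon>) h \<otimes> left_part \<epsilon> h = h"
  using C_subgroup by (simp add: left_part_def m_assoc[symmetric])

lemma left_part_mult:
  "h \<in> carrier H \<Longrightarrow> c \<in> C \<epsilon> \<Longrightarrow> left_part \<epsilon> (h \<otimes> c) = left_part \<epsilon> h \<otimes> c"
  using C_subgroup C_carrier by (simp add: left_part_def left_rep_mult m_assoc)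

lemma left_part_eq_one_iff:
  assumes "h \<in> carrier H"
  shows "left_part \<epsilon> h = \<one> \<longleftrightarrow> left_rep (C \<epsilon>) h = h"
proof
  assume "left_part \<epsilon> h = \<one>"
  then show "left_rep (C \<epsilon>) h = h"
    using left_rep_left_part[OF assms, of \<epsilon>] C_subgroup assms by simp
next
  assume "left_rep (C \<epsilon>) h = h"
  then show "left_part \<epsilon> h = \<one>" using assms by (simp add: left_part_def)
qed

lemma act_cases:
  obtains (pop) r' n' where "left_rep (C \<epsilon>) h = \<one>" "n = (\<not> \<epsilon>, r') # n'"
      "act \<epsilon> (n, h) = (n', r' \<otimes> \<phi> \<epsilon> (left_part \<epsilon> h))"
  | (push) "\<not> (left_rep (C \<epsilon>) h = \<one> \<and> n \<noteq> [] \<and> fst (hd n) = (\<not> \<epsilon>))"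
      "act \<epsilon> (n, h) = ((\<epsilon>, left_rep (C \<epsilon>) h) # n, \<phi> \<epsilon> (left_part \<epsilon> h))"
proof (cases "left_rep (C \<epsilon>) h = \<one> \<and> n \<noteq> [] \<and> fst (hd n) = (\<not> \<epsilon>)")
  case True
  then obtain r' n' where "n = (\<not> \<epsilon>, r') # n'" by (cases n) auto
  then show ?thesis using True pop by (simp add: act_def left_part_def)
next
  case False
  moreover have "act \<epsilon> (n, h) = ((\<epsilon>, left_rep (C \<epsilon>) h) # n, \<phi> \<epsilon> (left_part \<epsilon> h))"
    unfolding act_def left_part_def Let_def prod.case using False by (rule if_not_P)
  ultimately show ?thesis by (rule push)
qed

lemma act_pop:
  "left_rep (C \<epsilon>) h = \<one> \<Longrightarrow> act \<epsilon> ((\<not> \<epsilon>, r) # n, h) = (n, r \<otimes> \<phi> \<epsilon> (left_part \<epsilon> h))"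
  by (simp add: act_def left_part_def)

lemma act_push:
  "\<not> (left_rep (C \<epsilon>) h = \<one> \<and> n \<noteq> [] \<and> fst (hd n) = (\<not> \<epsilon>)) \<Longrightarrow>
    act \<epsilon> (n, h) = ((\<epsilon>, left_rep (C \<epsilon>) h) # n, \<phi> \<epsilon> (left_part \<epsilon> h))"
  unfolding act_def left_part_def Let_def prod.case by (rule if_not_P)

lemma act_closed:
  assumes "x \<in> states"
  shows "act \<epsilon> x \<in> states"
proof -
  obtain n h where x: "x = (n, h)" by (cases x)
  then have h: "h \<in> carrier H" and n: "reduced n" using assms by (auto simp: states_def)
  have c: "\<phi> \<epsilon> (left_part \<epsilon> h) \<in> carrier H" using \<phi>_carrier left_part_closed[OF h] by blast
  show ?thesis
    unfolding x
  proof (cases rule: act_cases[of \<epsilon> h n])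
    case (pop r' n')
    then show "act \<epsilon> (n, h) \<in> states" using n c by (simp add: states_def)
  next
    case push
    then show "act \<epsilon> (n, h) \<in> states"
      unfolding push(2) using n c C_subgroup h by (simp add: states_def left_rep_idem)
  qed
qed

text \<open>A pop is undone by a push and conversely. After a pop, the last clause of
  \<open>reduced\<close> prevents a second pop, and \<open>r\<close> is restored because it is a
  chosen representative.\<close>

lemma act_act:
  assumes "x \<in> states"
  shows "act (\<not> \<epsilon>) (act \<epsilon> x) = x"
proof -
  obtain n h where x: "x = (n, h)" by (cases x)
  then have h: "h \<in> carrier H" and n: "reduced n" using assms by (auto simp: states_def)
  let ?c = "left_part \<epsilon> h"
  have c: "?c \<in> C \<epsilon>" by (rule left_part_closed[OF h])
  note c' = \<phi>_closed[OF c] \<phi>_carrier[OF c]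
  show ?thesis
    unfolding x
  proof (cases rule: act_cases[of \<epsilon> h n])
    case (pop r n')
    then have r: "r \<in> carrier H" "left_rep (C (\<not> \<epsilon>)) r = r" "\<not> (r = \<one> \<and> n' \<noteq> [] \<and> fst (hd n') = \<epsilon>)"
      using n by auto
    have rep: "left_rep (C (\<not> \<epsilon>)) (r \<otimes> \<phi> \<epsilon> ?c) = r"
      using r c' C_subgroup by (simp add: left_rep_mult)
    have "left_part (\<not> \<epsilon>) (r \<otimes> \<phi> \<epsilon> ?c) = \<phi> \<epsilon> ?c"
      using r(1) c' left_part_eq_one_iff[THEN iffD2, OF r(1,2)] by (simp add: left_part_mult)
    moreover have "?c = h" using left_rep_left_part[OF h, of \<epsilon>] pop(1) C_carrier[OF c] by simp
    ultimately show "act (\<not> \<epsilon>) (act \<epsilon> (n, h)) = (n, h)"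
      unfolding pop(3) using r(3) rep \<phi>_inverse[OF c] pop(2) by (subst act_push) auto
  next
    case push
    have rep: "left_rep (C (\<not> \<epsilon>)) (\<phi> \<epsilon> ?c) = \<one>"
      using c' by (simp add: left_rep_one)
    then have "left_part (\<not> \<epsilon>) (\<phi> \<epsilon> ?c) = \<phi> \<epsilon> ?c" using c' by (simp add: left_part_def)
    then show "act (\<not> \<epsilon>) (act \<epsilon> (n, h)) = (n, h)"
      unfolding push(2) using act_pop[OF rep, of "left_rep (C \<epsilon>) h" n] \<phi>_inverse[OF c] left_rep_left_part[OF h]
      by simp
  qed
qed

text \<open>This is the relation \<open>c \<tau>(\<epsilon>) = \<tau>(\<epsilon>) \<phi>(\<epsilon>,
  c)\<close> on states: multiplying by \<open>c\<close> leaves the representative unchanged, so both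
  runs take the same branch.\<close>

lemma act_mult:
  assumes "(n, h) \<in> states" "c \<in> C \<epsilon>"
  shows "act \<epsilon> (n, h \<otimes> c) = map_prod id (\<lambda>k. k \<otimes> \<phi> \<epsilon> c) (act \<epsilon> (n, h))"
proof -
  have h: "h \<in> carrier H" and n: "reduced n" using assms by (auto simp: states_def)
  have rep: "left_rep (C \<epsilon>) (h \<otimes> c) = left_rep (C \<epsilon>) h"
    using C_subgroup h assms(2) by (rule left_rep_mult)
  have part: "\<phi> \<epsilon> (left_part \<epsilon> (h \<otimes> c)) = \<phi> \<epsilon> (left_part \<epsilon> h) \<otimes> \<phi> \<epsilon> c"
    using h assms(2) left_part_closed[OF h] by (simp add: left_part_mult \<phi>_mult)
  have cl: "\<phi> \<epsilon> (left_part \<epsilon> h) \<in> carrier H" "\<phi> \<epsilon> c \<in> carrier H"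
    using \<phi>_carrier left_part_closed[OF h] assms(2) by blast+
  show ?thesis
  proof (cases rule: act_cases[of \<epsilon> h n])
    case (pop r n')
    then have "r \<in> carrier H" using n by simp
    then show ?thesis
      using pop rep part cl act_pop[of \<epsilon> "h \<otimes> c" r n'] by (simp add: m_assoc)
  next
    case push
    then show ?thesis unfolding push(2) using rep part by (subst act_push) auto
  qed
qed

end

text \<open>What the tree and the flow use about the extension, kept apart from its construction by
  words. \<open>nf_eq_one\<close> is what leaves the identity as the only vertex without a parent
  arc.\<close>

locale hnn_normal_form = hnn_action H C \<phi> + G: group G
  for H :: "('a, 'b) monoid_scheme" (structure) and C \<phi> and G :: "('g, 'c) monoid_scheme" +
  fixes \<iota> :: "'a \<Rightarrow> 'g" and \<tau> :: "bool \<Rightarrow> 'g" and nf :: "'g \<Rightarrow> (bool \<times> 'a) list \<times> 'a"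
  assumes \<iota>_hom: "\<iota> \<in> hom H G"
    and \<tau>_closed [simp]: "\<tau> \<epsilon> \<in> carrier G"
    and inv_\<tau>: "inv\<^bsub>G\<^esub> (\<tau> \<epsilon>) = \<tau> (\<not> \<epsilon>)"
    and \<iota>_\<tau>: "c \<in> C \<epsilon> \<Longrightarrow> \<iota> c \<otimes>\<^bsub>G\<^esub> \<tau> \<epsilon> = \<tau> \<epsilon> \<otimes>\<^bsub>G\<^esub> \<iota> (\<phi> \<epsilon> c)"
    and generate_G: "generate G (\<iota> ` carrier H \<union> range \<tau>) = carrier G"
    and nf_states: "g \<in> carrier G \<Longrightarrow> nf g \<in> states"
    and nf_one: "nf \<one>\<^bsub>G\<^esub> = ([], \<one>)"
    and nf_\<iota>: "g \<in> carrier G \<Longrightarrow> k \<in> carrier H \<Longrightarrow>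
      nf (g \<otimes>\<^bsub>G\<^esub> \<iota> k) = (fst (nf g), snd (nf g) \<otimes> k)"
    and nf_\<tau>: "g \<in> carrier G \<Longrightarrow> nf (g \<otimes>\<^bsub>G\<^esub> \<tau> \<epsilon>) = act \<epsilon> (nf g)"
    and nf_eq_one: "g \<in> carrier G \<Longrightarrow> nf g = ([], \<one>) \<Longrightarrow> g = \<one>\<^bsub>G\<^esub>"

section \<open>The maximal tree of the HNN extension\<close>

lemma (in cayley) sym_edges_iff:
  assumes "P \<subseteq> carrier G \<times> X" "e \<in> carrier G \<times> X"
  shows "e \<in> sym_edges G P \<longleftrightarrow> e \<in> P \<or> rev_edge G e \<in> P"
proof -
  have "e \<in> rev_edge G ` P \<longleftrightarrow> rev_edge G e \<in> P"
  proof
    assume "e \<in> rev_edge G ` P"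
    then obtain f where "f \<in> P" "e = rev_edge G f" by blast
    then show "rev_edge G e \<in> P" using assms(1) rev_edge_simps(4)[of f] by auto
  next
    assume "rev_edge G e \<in> P"
    then have "rev_edge G (rev_edge G e) \<in> rev_edge G ` P" by (rule imageI)
    then show "e \<in> rev_edge G ` P" using rev_edge_simps(4)[OF assms(2)] by simp
  qed
  then show ?thesis by (simp add: sym_edges_def)
qed

context hnn_normal_form
begin

lemma \<iota>_closed [simp]: "h \<in> carrier H \<Longrightarrow> \<iota> h \<in> carrier G"
  using \<iota>_hom by (rule hom_in_carrier)

lemma \<iota>_mult: "h \<in> carrier H \<Longrightarrow> k \<in> carrier H \<Longrightarrow> \<iota> (h \<otimes> k) = \<iota> h \<otimes>\<^bsub>G\<^esub> \<iota> k"
  using \<iota>_hom by (rule hom_mult)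

lemma group_hom_\<iota>: "group_hom H G \<iota>"
  using \<iota>_hom by unfold_locales

lemma \<iota>_one [simp]: "\<iota> \<one> = \<one>\<^bsub>G\<^esub>"
  using group_hom_\<iota> by (rule group_hom.hom_one)

lemma \<iota>_inv: "h \<in> carrier H \<Longrightarrow> \<iota> (inv h) = inv\<^bsub>G\<^esub> \<iota> h"
  using group_hom_\<iota> by (rule group_hom.hom_inv)

lemma nf_\<iota>_one: "h \<in> carrier H \<Longrightarrow> nf (\<iota> h) = ([], h)"
  using nf_\<iota>[of "\<one>\<^bsub>G\<^esub>" h] by (simp add: nf_one)

lemma nf_\<tau>_one: "nf (\<tau> \<epsilon>) = ([(\<epsilon>, \<one>)], \<one>)"
proof -
  have "left_part \<epsilon> \<one> = \<one>" by (simp add: left_part_eq_one_iff left_rep_one)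
  then show ?thesis
    using nf_\<tau>[of "\<one>\<^bsub>G\<^esub>" \<epsilon>] act_push[of \<epsilon> "\<one>" "[]"] by (simp add: nf_one left_rep_one)
qed

text \<open>The classical embedding of the base group, read off from normal forms.\<close>

lemma \<iota>_inj:
  assumes "h \<in> carrier H" "k \<in> carrier H"
  shows "\<iota> h = \<iota> k \<longleftrightarrow> h = k"
proof
  assume "\<iota> h = \<iota> k"
  then have "nf (\<iota> h) = nf (\<iota> k)" by (rule arg_cong)
  then show "h = k" unfolding assms[THEN nf_\<iota>_one] by simp
qed simp

lemma \<tau>_inj: "\<tau> \<epsilon> = \<tau> \<delta> \<longleftrightarrow> \<epsilon> = \<delta>"
proof
  assume "\<tau> \<epsilon> = \<tau> \<delta>"
  then have "nf (\<tau> \<epsilon>) = nf (\<tau> \<delta>)" by (rule arg_cong)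
  then show "\<epsilon> = \<delta>" unfolding nf_\<tau>_one by simp
qed simp

lemma \<iota>_neq_\<tau>:
  assumes "h \<in> carrier H"
  shows "\<iota> h \<noteq> \<tau> \<epsilon>"
proof
  assume "\<iota> h = \<tau> \<epsilon>"
  then have "nf (\<iota> h) = nf (\<tau> \<epsilon>)" by (rule arg_cong)
  then show False unfolding nf_\<iota>_one[OF assms] nf_\<tau>_one by simp
qed

text \<open>The coordinate of \<open>g\<close> within its coset g H: the vertex with value
  \<open>\<one>\<close> serves as origin, and an edge labelled \<open>\<iota> a\<close> multiplies
  the coordinate by \<open>a\<close>.\<close>

definition base_part :: "'g \<Rightarrow> 'a" where
  "base_part g = snd (nf g)"

lemma base_part_closed [simp]: "g \<in> carrier G \<Longrightarrow> base_part g \<in> carrier H"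
  using nf_states[of g] by (auto simp: states_def base_part_def)

lemma base_part_\<iota>:
  "g \<in> carrier G \<Longrightarrow> k \<in> carrier H \<Longrightarrow> base_part (g \<otimes>\<^bsub>G\<^esub> \<iota> k) = base_part g \<otimes> k"
  by (simp add: base_part_def nf_\<iota>)

end

text \<open>The tree of H is rooted at \<open>\<one>\<close> so that the root of each translated
  tree is the vertex from which the edge to the closer coset departs.\<close>

locale hnn_stacking = hnn_normal_form H C \<phi> G \<iota> \<tau> nf + H: cayley H X
  for H :: "('a, 'b) monoid_scheme" (structure) and C \<phi> and G :: "('g, 'c) monoid_scheme"
    and \<iota> \<tau> nf X +
  fixes P :: "('a \<times> 'a) set"
  assumes P: "parent_arcs H X \<one> (carrier H) P"
begin

definition gens :: "'g set" where
  "gens = \<iota> ` X \<union> range \<tau>"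

lemma gens_intros [simp]: "a \<in> X \<Longrightarrow> \<iota> a \<in> gens" "\<tau> \<epsilon> \<in> gens"
  by (auto simp: gens_def)

lemma inv_closed_gen_set_gens: "inv_closed_gen_set G gens"
proof -
  have X: "X \<subseteq> carrier H" by (rule H.X_carrier)
  have sub: "gens \<subseteq> carrier G" by (auto simp: gens_def)
  have "inv\<^bsub>G\<^esub> a \<in> gens" if "a \<in> gens" for a
    using that by (auto simp: gens_def inv_\<tau> \<iota>_inv[symmetric] intro: H.X_inv)
  moreover have "\<one>\<^bsub>G\<^esub> \<notin> gens"
  proof
    assume "\<one>\<^bsub>G\<^esub> \<in> gens"
    then consider x where "x \<in> X" "\<iota> x = \<iota> \<one>" | \<epsilon> where "\<iota> \<one> = \<tau> \<epsilon>"
      by (auto simp: gens_def)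
    then show False
    proof cases
      case 1
      then show False using \<iota>_inj[of x \<one>] H.one_notin_X by auto
    next
      case 2
      then show False using \<iota>_neq_\<tau>[of \<one>] by blast
    qed
  qed
  moreover have "generate G gens = carrier G"
  proof
    show "generate G gens \<subseteq> carrier G" using sub by (rule G.generate_incl)
    have "\<iota> ` carrier H = generate G (\<iota> ` X)"
      using group_hom.generate_img[OF group_hom_\<iota> X] H.X_generate by simp
    then have "\<iota> ` carrier H \<subseteq> generate G gens"
      using G.mono_generate[of "\<iota> ` X" gens] by (auto simp: gens_def)
    moreover have "range \<tau> \<subseteq> generate G gens"
      by (auto simp: gens_def intro: generate.incl)
    ultimately show "carrier G \<subseteq> generate G gens"
      using G.generate_subgroup_incl[OF _ G.generate_is_subgroup[OF sub], of "\<iota> ` carrier H \<union> range \<tau>"]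
        generate_G by auto
  qed
  ultimately show ?thesis
    using sub H.X_finite by (auto simp: inv_closed_gen_set_def gens_def)
qed

sublocale G: cayley G gens
  by unfold_locales (rule inv_closed_gen_set_gens)

text \<open>Each coset of \<open>H\<close> carries a translate of the tree of \<open>H\<close>, and it is joined to the coset
  closer to \<open>H\<close> by a single edge, whose farther end has trivial base part.\<close>

definition tree_arcs :: "('g \<times> 'g) set" where
  "tree_arcs =
     {(g, \<iota> a) | g a. g \<in> carrier G \<and> (base_part g, a) \<in> P} \<union>
     {(g, \<tau> \<epsilon>) | g \<epsilon>. g \<in> carrier G \<and> (\<exists>r n. nf g = ((\<not> \<epsilon>, r) # n, \<one>))}"

lemma P_subset: "P \<subseteq> carrier H \<times> X"
  using H.parent_arcs_subset[OF P] by blast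

lemma tree_arcs_\<iota>:
  assumes "a \<in> X"
  shows "(g, \<iota> a) \<in> tree_arcs \<longleftrightarrow> g \<in> carrier G \<and> (base_part g, a) \<in> P"
proof -
  have "a' = a" if "\<iota> a = \<iota> a'" "(h, a') \<in> P" for a' h
    using that \<iota>_inj[of a a'] assms P_subset by auto
  then show ?thesis
    using \<iota>_neq_\<tau>[of a] assms by (fastforce simp: tree_arcs_def)
qed

lemma tree_arcs_\<tau>:
  "(g, \<tau> \<epsilon>) \<in> tree_arcs \<longleftrightarrow> g \<in> carrier G \<and> (\<exists>r n. nf g = ((\<not> \<epsilon>, r) # n, \<one>))"
proof -
  have "\<tau> \<epsilon> \<noteq> \<iota> a" if "(h, a) \<in> P" for a h
    using \<iota>_neq_\<tau>[of a \<epsilon>] that P_subset by auto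
  then show ?thesis by (auto simp: tree_arcs_def \<tau>_inj)
qed

lemma edge_cases:
  assumes "e \<in> carrier G \<times> gens"
  obtains (base) g a where "e = (g, \<iota> a)" "g \<in> carrier G" "a \<in> X"
  | (stable) g \<epsilon> where "e = (g, \<tau> \<epsilon>)" "g \<in> carrier G"
  using assms by (auto simp: gens_def)

lemma tree_arcs_subset: "tree_arcs \<subseteq> carrier G \<times> gens"
  using P_subset by (auto simp: tree_arcs_def gens_def)

text \<open>With base part \<open>\<one>\<close> and opposite last letter the action pops: the
  connecting arc deletes the last stable letter.\<close>

lemma nf_parent_\<tau>:
  assumes "g \<in> carrier G" "nf g = ((\<not> \<epsilon>, r) # n, \<one>)"
  shows "nf (g \<otimes>\<^bsub>G\<^esub> \<tau> \<epsilon>) = (n, r)"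
proof -
  have "left_part \<epsilon> \<one> = \<one>" by (simp add: left_part_eq_one_iff left_rep_one)
  moreover have "r \<in> carrier H" using nf_states[OF assms(1)] assms(2) by (simp add: states_def)
  ultimately show ?thesis
    using assms act_pop[of \<epsilon> \<one> r n] by (simp add: nf_\<tau> left_rep_one)
qed

text \<open>A nontrivial base part is moved by a parent arc of H, a trivial one by deletion of the
  last stable letter. The two families never compete at a vertex, and both fail only at the trivial
  normal form.\<close>

lemma parent_arcs_tree_arcs: "parent_arcs G gens \<one>\<^bsub>G\<^esub> (carrier G) tree_arcs"
proof -
  let ?R = "(\<lambda>e. (edge_target H e, fst e)) ` P"
  have fstP: "fst ` P = carrier H - {\<one>}" and injP: "inj_on fst P" and wfP: "wf ?R"
    using P by (auto simp: parent_arcs_def)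
  \<comment> \<open>\<open>\<one>\<close> is the root, so vertices with trivial base part emit no
    arc of the first family.\<close>
  have noP: "(\<one>, a) \<notin> P" for a
    using fstP by force
  have fst1: "fst e \<in> carrier G - {\<one>\<^bsub>G\<^esub>}" if e: "e \<in> tree_arcs" for e
  proof -
    have "e \<in> carrier G \<times> gens" using e tree_arcs_subset by blast
    then show ?thesis
    proof (cases rule: edge_cases)
      case (base g a)
      then show ?thesis using e noP by (auto simp: tree_arcs_\<iota> base_part_def nf_one)
    next
      case (stable g \<epsilon>)
      then show ?thesis using e by (auto simp: tree_arcs_\<tau> nf_one)
    qed
  qed
  have fst2: "g \<in> fst ` tree_arcs" if g: "g \<in> carrier G" "g \<noteq> \<one>\<^bsub>G\<^esub>" for g
  proof (cases "base_part g = \<one>")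
    case True
    then obtain n where n: "nf g = (n, \<one>)" by (cases "nf g") (auto simp: base_part_def)
    then obtain \<epsilon> r n' where "n = (\<epsilon>, r) # n'"
      using nf_eq_one[of g] g by (cases n) auto
    then have "(g, \<tau> (\<not> \<epsilon>)) \<in> tree_arcs" using n g by (simp add: tree_arcs_\<tau>)
    then show ?thesis by force
  next
    case False
    then have "base_part g \<in> fst ` P" using g fstP by simp
    then obtain a where a: "(base_part g, a) \<in> P" by auto
    then have "(g, \<iota> a) \<in> tree_arcs" using g P_subset by (auto simp: tree_arcs_def)
    then show ?thesis by force
  qed
  have fst: "fst ` tree_arcs = carrier G - {\<one>\<^bsub>G\<^esub>}"
  proof (intro equalityI subsetI)
    fix g assume "g \<in> fst ` tree_arcs"
    then show "g \<in> carrier G - {\<one>\<^bsub>G\<^esub>}" by (elim imageE) (simp only: fst1)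
  next
    fix g assume "g \<in> carrier G - {\<one>\<^bsub>G\<^esub>}"
    then show "g \<in> fst ` tree_arcs" using fst2 by simp
  qed
  have inj: "inj_on fst tree_arcs"
  proof (rule inj_onI)
    fix e e' assume e: "e \<in> tree_arcs" "e' \<in> tree_arcs" "fst e = fst e'"
    then have ee: "e \<in> carrier G \<times> gens" "e' \<in> carrier G \<times> gens" using tree_arcs_subset by auto
    from ee(1) show "e = e'"
    proof (cases rule: edge_cases)
      case base: (base g a)
      from ee(2) show ?thesis
      proof (cases rule: edge_cases)
        case (base g' a')
        then show ?thesis
          using e \<open>e = (g, \<iota> a)\<close> \<open>a \<in> X\<close> inj_onD[OF injP, of "(base_part g, a)" "(base_part g, a')"]
          by (simp add: tree_arcs_\<iota>)
      next
        case (stable g' \<epsilon>)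
        then show ?thesis using e base noP by (auto simp: tree_arcs_\<iota> tree_arcs_\<tau> base_part_def)
      qed
    next
      case stable: (stable g \<epsilon>)
      from ee(2) show ?thesis
      proof (cases rule: edge_cases)
        case (base g' a')
        then show ?thesis using e stable noP by (auto simp: tree_arcs_\<iota> tree_arcs_\<tau> base_part_def)
      next
        case (stable g' \<epsilon>')
        then show ?thesis using e \<open>e = (g, \<tau> \<epsilon>)\<close> by (auto simp: tree_arcs_\<tau> \<tau>_inj)
      qed
    qed
  qed
  \<comment> \<open>Deleting a stable letter shortens the prefix; an arc inside a coset keeps the
    prefix and moves to the parent in H.\<close>
  have "(edge_target G e, fst e) \<in> inv_image (less_than <*lex*> ?R) (\<lambda>g. (length (fst (nf g)), snd (nf g)))"
    if e: "e \<in> tree_arcs" for e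
  proof -
    have "e \<in> carrier G \<times> gens" using e tree_arcs_subset by blast
    then show ?thesis
    proof (cases rule: edge_cases)
      case (base g a)
      then have "(base_part g, a) \<in> P" using e by (simp add: tree_arcs_\<iota>)
      then have "(base_part g \<otimes> a, base_part g) \<in> ?R" by force
      then show ?thesis using base by (simp add: nf_\<iota> base_part_def)
    next
      case (stable g \<epsilon>)
      then show ?thesis using e by (auto simp: tree_arcs_\<tau> nf_parent_\<tau>)
    qed
  qed
  then have "wf ((\<lambda>e. (edge_target G e, fst e)) ` tree_arcs)"
    by (intro wf_subset[OF wf_inv_image[OF wf_lex_prod[OF wf_less_than wfP]]]) blast
  moreover have "edge_target G ` tree_arcs \<subseteq> carrier G"
    using tree_arcs_subset by (force dest: G.X_closed)
  ultimately show ?thesis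
    using fst inj tree_arcs_subset by (simp add: parent_arcs_def)
qed

lemma sym_tree_arcs_\<iota>:
  assumes g: "g \<in> carrier G" and a: "a \<in> X"
  shows "(g, \<iota> a) \<in> sym_edges G tree_arcs \<longleftrightarrow> (base_part g, a) \<in> sym_edges H P"
proof -
  have "rev_edge G (g, \<iota> a) = (g \<otimes>\<^bsub>G\<^esub> \<iota> a, \<iota> (inv a))"
    using a by (simp add: rev_edge_def \<iota>_inv)
  then have "rev_edge G (g, \<iota> a) \<in> tree_arcs \<longleftrightarrow> rev_edge H (base_part g, a) \<in> P"
    using assms H.X_inv by (simp add: tree_arcs_\<iota> base_part_\<iota>) (simp add: rev_edge_def)
  then show ?thesis
    using assms by (simp add: G.sym_edges_iff[OF tree_arcs_subset] H.sym_edges_iff[OF P_subset]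
        gens_def tree_arcs_\<iota>)
qed

text \<open>A base part with trivial \<open>left_part\<close> is a chosen representative. If the
  action pops, it is \<open>\<one>\<close> and the edge is a parent arc; if the action pushes, the
  new base part is \<open>\<one>\<close> and the reversed edge is one.\<close>

lemma sym_tree_arcs_\<tau>:
  assumes g: "g \<in> carrier G"
  shows "(g, \<tau> \<epsilon>) \<in> sym_edges G tree_arcs \<longleftrightarrow> left_part \<epsilon> (base_part g) = \<one>"
proof -
  obtain n h where nf: "nf g = (n, h)" by (cases "nf g")
  have h: "h \<in> carrier H" "base_part g = h"
    using nf_states[OF g] nf by (auto simp: states_def base_part_def)
  have rev: "rev_edge G (g, \<tau> \<epsilon>) = (g \<otimes>\<^bsub>G\<^esub> \<tau> \<epsilon>, \<tau> (\<not> \<epsilon>))"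
    by (simp add: rev_edge_def inv_\<tau>)
  have "(g, \<tau> \<epsilon>) \<in> sym_edges G tree_arcs \<longleftrightarrow>
      (\<exists>r n. nf g = ((\<not> \<epsilon>, r) # n, \<one>)) \<or> (\<exists>r n. nf (g \<otimes>\<^bsub>G\<^esub> \<tau> \<epsilon>) = ((\<epsilon>, r) # n, \<one>))"
    using g by (simp add: G.sym_edges_iff[OF tree_arcs_subset] rev tree_arcs_\<tau>)
  also have "\<dots> \<longleftrightarrow> left_part \<epsilon> h = \<one>"
  proof
    assume "(\<exists>r n. nf g = ((\<not> \<epsilon>, r) # n, \<one>)) \<or> (\<exists>r n. nf (g \<otimes>\<^bsub>G\<^esub> \<tau> \<epsilon>) = ((\<epsilon>, r) # n, \<one>))"
    then show "left_part \<epsilon> h = \<one>"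
    proof (elim disjE exE)
      fix r n' assume "nf g = ((\<not> \<epsilon>, r) # n', \<one>)"
      then show ?thesis using nf by (simp add: left_part_eq_one_iff left_rep_one)
    next
      fix r n' assume *: "nf (g \<otimes>\<^bsub>G\<^esub> \<tau> \<epsilon>) = ((\<epsilon>, r) # n', \<one>)"
      have "g \<otimes>\<^bsub>G\<^esub> \<tau> \<epsilon> \<otimes>\<^bsub>G\<^esub> \<tau> (\<not> \<epsilon>) = g"
        using g by (simp add: inv_\<tau>[symmetric] G.m_assoc)
      then have "nf g = (n', r)"
        using nf_parent_\<tau>[of "g \<otimes>\<^bsub>G\<^esub> \<tau> \<epsilon>" "\<not> \<epsilon>" r n'] * g by simp
      moreover have "left_rep (C \<epsilon>) r = r"
        using nf_states[of "g \<otimes>\<^bsub>G\<^esub> \<tau> \<epsilon>"] * g by (simp add: states_def)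
      ultimately show ?thesis using nf h by (simp add: left_part_eq_one_iff)
    qed
  next
    assume one: "left_part \<epsilon> h = \<one>"
    then have rep: "left_rep (C \<epsilon>) h = h" using h by (simp add: left_part_eq_one_iff)
    show "(\<exists>r n. nf g = ((\<not> \<epsilon>, r) # n, \<one>)) \<or> (\<exists>r n. nf (g \<otimes>\<^bsub>G\<^esub> \<tau> \<epsilon>) = ((\<epsilon>, r) # n, \<one>))"
    proof (cases rule: act_cases[of \<epsilon> h n])
      case (pop r' n')
      then show ?thesis using nf rep by simp
    next
      case push
      then show ?thesis using nf rep one g by (simp add: nf_\<tau>)
    qed
  qed
  finally show ?thesis using h by simp
qed

end

section \<open>The flow function\<close>

lemma (in cayley) flow_awalk:
  assumes "flow_function G X T \<Phi>" "g \<in> carrier G" "a \<in> X"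
  shows "pre_digraph.awalk (cayley_graph G X) g (\<Phi> (g, a)) (g \<otimes> a)"
  using assms unfolding flow_function_def by (auto simp: cayley_graph_eq_sub)

context hnn_stacking
begin

definition tree :: "('g, 'g \<times> 'g) pre_digraph" where
  "tree = cayley_sub G (carrier G) (sym_edges G tree_arcs)"

lemma maximal_tree: "maximal_tree G gens tree"
  unfolding tree_def by (rule G.parent_arcs_maximal_tree[OF parent_arcs_tree_arcs])

definition lift_edge :: "'g \<Rightarrow> 'a \<times> 'a \<Rightarrow> 'g \<times> 'g" where
  "lift_edge q = (\<lambda>(k, b). (q \<otimes>\<^bsub>G\<^esub> \<iota> k, \<iota> b))"

lemma lift_awalk:
  assumes "pre_digraph.awalk (cayley_graph H X) u p v" "q \<in> carrier G"
  shows "pre_digraph.awalk (cayley_graph G gens) (q \<otimes>\<^bsub>G\<^esub> \<iota> u) (map (lift_edge q) p) (q \<otimes>\<^bsub>G\<^esub> \<iota> v)"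
proof -
  interpret H: wf_digraph "cayley_graph H X" by (rule H.wf_digraph_cayley_graph)
  interpret G: wf_digraph "cayley_graph G gens" by (rule G.wf_digraph_cayley_graph)
  show ?thesis
    using assms(1)
  proof (induction p arbitrary: u)
    case Nil
    then have "u = v" "u \<in> carrier H"
      unfolding H.awalk_Nil_iff by (auto simp: cayley_graph_eq_sub)
    then show ?case
      using assms(2) by (simp add: G.awalk_Nil_iff) (simp add: cayley_graph_eq_sub)
  next
    case (Cons e p)
    obtain b where e: "e = (u, b)" "u \<in> carrier H" "b \<in> X"
      and p: "H.awalk (u \<otimes> b) p v"
      using Cons.prems unfolding H.awalk_Cons_iff by (cases e) (auto simp: cayley_graph_eq_sub)
    have "G.awalk (q \<otimes>\<^bsub>G\<^esub> \<iota> u \<otimes>\<^bsub>G\<^esub> \<iota> b) (map (lift_edge q) p) (q \<otimes>\<^bsub>G\<^esub> \<iota> v)"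
      using Cons.IH[OF p] e assms(2) by (simp add: \<iota>_mult G.m_assoc)
    then show ?case
      using e assms(2) by (simp add: G.awalk_Cons_iff lift_edge_def) (simp add: cayley_graph_eq_sub)
  qed
qed

lemma word_prod_map_\<iota>:
  "set w \<subseteq> carrier H \<Longrightarrow> word_prod G (map \<iota> w) = \<iota> (word_prod H w)"
  by (induction w) (simp_all add: \<iota>_mult)

text \<open>The flow carries a non-tree edge labelled \<open>\<tau> \<epsilon>\<close> across the strip of parallel edges one step
  closer to the tree edge.\<close>

theorem stackable_over_gens:
  assumes fin_gen: "\<And>\<epsilon>. \<exists>S. finite S \<and> S \<subseteq> carrier H \<and> generate H S = C \<epsilon>"
    and flow: "flow_function H X (cayley_sub H (carrier H) (sym_edges H P)) \<Phi>" (is "flow_function H X ?T \<Phi>")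
    and bounded: "bounded_flow H X \<Phi>"
  shows "stackable_over G gens"
proof -
  have "\<exists>S (l :: 'a \<Rightarrow> nat). finite S \<and> S \<subseteq> C \<epsilon> \<and> (\<forall>c\<in>C \<epsilon>. c \<noteq> \<one> \<longrightarrow> (\<exists>s\<in>S. l (c \<otimes> s) < l c))" for \<epsilon>
  proof -
    obtain S where S: "finite S" "S \<subseteq> carrier H" "generate H S = C \<epsilon>"
      using fin_gen by blast
    obtain S' and l :: "'a \<Rightarrow> nat" where "finite S'" "S' \<subseteq> generate H S"
      "\<And>c. c \<in> generate H S \<Longrightarrow> c \<noteq> \<one> \<Longrightarrow> \<exists>s\<in>S'. l (c \<otimes> s) < l c"
      using generate_word_length[OF S(1,2)] by metis
    then show ?thesis unfolding S(3) by blast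
  qed
  then have "\<forall>\<epsilon>. \<exists>S (l :: 'a \<Rightarrow> nat). finite S \<and> S \<subseteq> C \<epsilon> \<and> (\<forall>c\<in>C \<epsilon>. c \<noteq> \<one> \<longrightarrow> (\<exists>s\<in>S. l (c \<otimes> s) < l c))"
    by blast
  then obtain S where "\<forall>\<epsilon>. \<exists>l :: 'a \<Rightarrow> nat. finite (S \<epsilon>) \<and> S \<epsilon> \<subseteq> C \<epsilon> \<and>
      (\<forall>c\<in>C \<epsilon>. c \<noteq> \<one> \<longrightarrow> (\<exists>s\<in>S \<epsilon>. l (c \<otimes> s) < l c))"
    by (drule_tac choice) blast
  then obtain l :: "bool \<Rightarrow> 'a \<Rightarrow> nat" where Sl: "\<forall>\<epsilon>. finite (S \<epsilon>) \<and> S \<epsilon> \<subseteq> C \<epsilon> \<and>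
      (\<forall>c\<in>C \<epsilon>. c \<noteq> \<one> \<longrightarrow> (\<exists>s\<in>S \<epsilon>. l \<epsilon> (c \<otimes> s) < l \<epsilon> c))"
    by (drule_tac choice) blast
  then have S_finite: "finite (S \<epsilon>)" and S_C: "s \<in> S \<epsilon> \<Longrightarrow> s \<in> C \<epsilon>" for \<epsilon> s
    by blast+
  \<comment> \<open>Each element of H gets one fixed word over \<open>X\<close>; only finitely many
    of these words will enter the detours.\<close>
  have "\<forall>h\<in>carrier H. \<exists>w. set w \<subseteq> X \<and> word_prod H w = h"
    using generate_imp_word[OF H.X_carrier] H.X_inv H.X_generate by blast
  then obtain w where w: "\<And>h. h \<in> carrier H \<Longrightarrow> set (w h) \<subseteq> X" "\<And>h. h \<in> carrier H \<Longrightarrow> word_prod H (w h) = h"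
    by (drule_tac bchoice) blast
  define step where "step \<epsilon> h = (SOME s. s \<in> S \<epsilon> \<and> l \<epsilon> (left_part \<epsilon> h \<otimes> s) < l \<epsilon> (left_part \<epsilon> h))" for \<epsilon> h
  have step: "step \<epsilon> h \<in> S \<epsilon> \<and> l \<epsilon> (left_part \<epsilon> h \<otimes> step \<epsilon> h) < l \<epsilon> (left_part \<epsilon> h)"
    if "h \<in> carrier H" "left_part \<epsilon> h \<noteq> \<one>" for \<epsilon> h
  proof -
    have "\<exists>s. s \<in> S \<epsilon> \<and> l \<epsilon> (left_part \<epsilon> h \<otimes> s) < l \<epsilon> (left_part \<epsilon> h)"
      using Sl left_part_closed[OF that(1), of \<epsilon>] that(2) by blast
    then show ?thesis unfolding step_def by (rule someI_ex)
  qed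
  define word where "word h = map \<iota> (w h)" for h
  have word: "set (word h) \<subseteq> gens" "set (word h) \<subseteq> \<iota> ` X" "word_prod G (word h) = \<iota> h" if "h \<in> carrier H" for h
  proof -
    show "set (word h) \<subseteq> \<iota> ` X" using w(1)[OF that] by (auto simp: word_def)
    then show "set (word h) \<subseteq> gens" by (auto simp: gens_def)
    have "set (w h) \<subseteq> carrier H" using w(1)[OF that] H.X_carrier by blast
    then show "word_prod G (word h) = \<iota> h" using w(2)[OF that] by (simp add: word_def word_prod_map_\<iota>)
  qed
  \<comment> \<open>Since \<open>inv s\<close> passes through \<open>\<tau> \<epsilon>\<close> as
    \<open>\<phi> \<epsilon> (inv s)\<close>, walking along \<open>s\<close>, crossing, and then
    walking along \<open>\<phi> \<epsilon> (inv s)\<close> ends where the original edge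
    ends.\<close>
  define detour where "detour \<epsilon> g s = word_path G g (word s) @ [(g \<otimes>\<^bsub>G\<^esub> \<iota> s, \<tau> \<epsilon>)] @
      word_path G (g \<otimes>\<^bsub>G\<^esub> \<iota> s \<otimes>\<^bsub>G\<^esub> \<tau> \<epsilon>) (word (\<phi> \<epsilon> (inv s)))" for \<epsilon> g s
  define base_label where "base_label x = (THE a. a \<in> X \<and> \<iota> a = x)" for x
  \<comment> \<open>The vertex of base part \<open>\<one>\<close> in the coset of \<open>g\<close>;
    translation by it turns positions in H into base parts.\<close>
  define base_pos where "base_pos g = g \<otimes>\<^bsub>G\<^esub> \<iota> (inv (base_part g))" for g
  define sgn where "sgn x \<longleftrightarrow> x = \<tau> True" for x
  define \<Psi> where "\<Psi> = (\<lambda>(g, x).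
      if x \<in> \<iota> ` X then map (lift_edge (base_pos g)) (\<Phi> (base_part g, base_label x))
      else if left_part (sgn x) (base_part g) = \<one> then [(g, x)]
      else detour (sgn x) g (step (sgn x) (base_part g)))"
  have label: "base_label (\<iota> a) = a" if "a \<in> X" for a
    unfolding base_label_def using that \<iota>_inj by (intro the_equality) auto
  have sgn: "sgn (\<tau> \<epsilon>) = \<epsilon>" for \<epsilon>
    by (simp add: sgn_def \<tau>_inj)
  have \<tau>_label: "\<tau> \<epsilon> \<notin> \<iota> ` X" for \<epsilon>
    using \<iota>_neq_\<tau> H.X_closed by (metis imageE)
  have pos: "base_pos g \<in> carrier G" "base_pos g \<otimes>\<^bsub>G\<^esub> \<iota> (base_part g) = g"
    "\<And>k. k \<in> carrier H \<Longrightarrow> base_part (base_pos g \<otimes>\<^bsub>G\<^esub> \<iota> k) = k" if g: "g \<in> carrier G" for g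
  proof -
    show pg: "base_pos g \<in> carrier G" using g by (simp add: base_pos_def)
    show "base_pos g \<otimes>\<^bsub>G\<^esub> \<iota> (base_part g) = g"
      using g by (simp add: base_pos_def G.m_assoc flip: \<iota>_mult)
    show "base_part (base_pos g \<otimes>\<^bsub>G\<^esub> \<iota> k) = k" if "k \<in> carrier H" for k
      using g that pg by (simp add: base_part_\<iota>) (simp add: base_pos_def base_part_\<iota>)
  qed
  have \<Psi>_base: "\<Psi> (g, \<iota> a) = map (lift_edge (base_pos g)) (\<Phi> (base_part g, a))" if "a \<in> X" for g a
    using that by (simp add: \<Psi>_def label)
  have \<Psi>_stable: "\<Psi> (g, \<tau> \<epsilon>) = (if left_part \<epsilon> (base_part g) = \<one> then [(g, \<tau> \<epsilon>)]
      else detour \<epsilon> g (step \<epsilon> (base_part g)))" for g \<epsilon>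
    by (simp add: \<Psi>_def \<tau>_label sgn)
  have arcs_G: "arcs (cayley_graph G gens) = carrier G \<times> gens"
    by (simp add: cayley_graph_eq_sub)
  have arcs_tree: "arcs tree = sym_edges G tree_arcs"
    by (simp add: tree_def)
  have \<Phi>_carrier: "set (\<Phi> (h, a)) \<subseteq> carrier H \<times> X" if "h \<in> carrier H" "a \<in> X" for h a
    using H.flow_awalk[OF flow that] by (auto simp: pre_digraph.awalk_def cayley_graph_eq_sub)

  have walk: "pre_digraph.awalk (cayley_graph G gens) (tail (cayley_graph G gens) e) (\<Psi> e)
      (head (cayley_graph G gens) e)" if "e \<in> carrier G \<times> gens" for e
    using that
  proof (cases rule: edge_cases)
    case (base g a)
    have "pre_digraph.awalk (cayley_graph G gens) (base_pos g \<otimes>\<^bsub>G\<^esub> \<iota> (base_part g))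
        (\<Psi> e) (base_pos g \<otimes>\<^bsub>G\<^esub> \<iota> (base_part g \<otimes> a))"
      unfolding base(1) \<Psi>_base[OF base(3)]
      using lift_awalk[OF H.flow_awalk[OF flow] pos(1)] base by simp
    moreover have "base_pos g \<otimes>\<^bsub>G\<^esub> \<iota> (base_part g \<otimes> a) = g \<otimes>\<^bsub>G\<^esub> \<iota> a"
      using pos(1,2)[OF base(2)] base by (simp add: \<iota>_mult flip: G.m_assoc)
    ultimately show ?thesis
      using pos(2)[OF base(2)] base(1) by (simp add: cayley_graph_eq_sub)
  next
    case (stable g \<epsilon>)
    interpret G: wf_digraph "cayley_graph G gens" by (rule G.wf_digraph_cayley_graph)
    have edge: "G.awalk k [(k, \<tau> \<epsilon>)] (k \<otimes>\<^bsub>G\<^esub> \<tau> \<epsilon>)" if "k \<in> carrier G" for k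
      using that by (simp add: G.awalk_Cons_iff G.awalk_Nil_iff) (simp add: cayley_graph_eq_sub)
    have "G.awalk g (\<Psi> (g, \<tau> \<epsilon>)) (g \<otimes>\<^bsub>G\<^esub> \<tau> \<epsilon>)"
    proof (cases "left_part \<epsilon> (base_part g) = \<one>")
      case True
      then show ?thesis using edge[OF stable(2)] by (simp add: \<Psi>_stable)
    next
      case False
      define s where "s = step \<epsilon> (base_part g)"
      have s: "s \<in> C \<epsilon>" "s \<in> carrier H"
        using step[of "base_part g" \<epsilon>] S_C[of s \<epsilon>] C_carrier[of s \<epsilon>] stable(2) False by (auto simp: s_def)
      have inv_s: "inv s \<in> C \<epsilon>" using s C_subgroup subgroup.m_inv_closed by metis
      note \<phi>s = \<phi>_carrier[OF inv_s]
      let ?k = "g \<otimes>\<^bsub>G\<^esub> \<iota> s"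
      have k: "?k \<in> carrier G" using stable s by simp
      have w1: "G.awalk g (word_path G g (word s)) ?k"
        using G.word_path_awalk[OF stable(2) word(1)[OF s(2)]] word(3)[OF s(2)] by simp
      have "G.awalk (?k \<otimes>\<^bsub>G\<^esub> \<tau> \<epsilon>) (word_path G (?k \<otimes>\<^bsub>G\<^esub> \<tau> \<epsilon>) (word (\<phi> \<epsilon> (inv s))))
          (?k \<otimes>\<^bsub>G\<^esub> \<tau> \<epsilon> \<otimes>\<^bsub>G\<^esub> \<iota> (\<phi> \<epsilon> (inv s)))"
        using G.word_path_awalk[of "?k \<otimes>\<^bsub>G\<^esub> \<tau> \<epsilon>" "word (\<phi> \<epsilon> (inv s))"] word(1,3)[OF \<phi>s] k by simp
      moreover have "?k \<otimes>\<^bsub>G\<^esub> \<tau> \<epsilon> \<otimes>\<^bsub>G\<^esub> \<iota> (\<phi> \<epsilon> (inv s)) = g \<otimes>\<^bsub>G\<^esub> \<tau> \<epsilon>"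
      proof -
        have "?k \<otimes>\<^bsub>G\<^esub> \<tau> \<epsilon> \<otimes>\<^bsub>G\<^esub> \<iota> (\<phi> \<epsilon> (inv s)) = ?k \<otimes>\<^bsub>G\<^esub> (\<iota> (inv s) \<otimes>\<^bsub>G\<^esub> \<tau> \<epsilon>)"
          using k \<phi>s by (simp add: G.m_assoc \<iota>_\<tau>[OF inv_s])
        also have "\<dots> = g \<otimes>\<^bsub>G\<^esub> (\<iota> s \<otimes>\<^bsub>G\<^esub> \<iota> (inv s)) \<otimes>\<^bsub>G\<^esub> \<tau> \<epsilon>"
          using stable s(2) by (simp add: G.m_assoc)
        also have "\<iota> s \<otimes>\<^bsub>G\<^esub> \<iota> (inv s) = \<one>\<^bsub>G\<^esub>"
          using s(2) by (simp add: \<iota>_inv)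
        also have "g \<otimes>\<^bsub>G\<^esub> \<one>\<^bsub>G\<^esub> \<otimes>\<^bsub>G\<^esub> \<tau> \<epsilon> = g \<otimes>\<^bsub>G\<^esub> \<tau> \<epsilon>" using stable by simp
        finally show ?thesis .
      qed
      ultimately have "G.awalk g (detour \<epsilon> g s) (g \<otimes>\<^bsub>G\<^esub> \<tau> \<epsilon>)"
        unfolding detour_def using w1 edge[OF k] by (metis G.awalk_appendI)
      then show ?thesis using False by (simp add: \<Psi>_stable s_def)
    qed
    then show ?thesis using stable(1) by (simp add: cayley_graph_eq_sub)
  qed

  have fixed: "\<Psi> e = [e]" if "e \<in> carrier G \<times> gens" "e \<in> sym_edges G tree_arcs" for e
    using that(1)
  proof (cases rule: edge_cases)
    case (base g a)
    then have "(base_part g, a) \<in> sym_edges H P" using that(2) sym_tree_arcs_\<iota> by simp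
    then have "\<Phi> (base_part g, a) = [(base_part g, a)]"
      using flow base by (simp add: flow_function_def cayley_graph_eq_sub)
    then show ?thesis using base pos(2)[OF base(2)] by (simp add: \<Psi>_base lift_edge_def)
  next
    case (stable g \<epsilon>)
    then show ?thesis using that(2) by (simp add: \<Psi>_stable sym_tree_arcs_\<tau>)
  qed

  \<comment> \<open>\<open>Suc\<close> puts every stable edge above every base edge, whose first
    component is 0. The pair \<open>(\<one>, \<one>)\<close> is a filler: stable edges are compared
    by the first component alone.\<close>
  define m where "m = (\<lambda>(g, x). if x \<in> \<iota> ` X then (0 :: nat, (base_part g, base_label x))
      else (Suc (l (sgn x) (left_part (sgn x) (base_part g))), (\<one>, \<one>)))"
  have m_base: "m (g, \<iota> a) = (0, (base_part g, a))" if "a \<in> X" for g a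
    using that by (simp add: m_def label)
  have m_stable: "m (g, \<tau> \<epsilon>) = (Suc (l \<epsilon> (left_part \<epsilon> (base_part g))), (\<one>, \<one>))" for g \<epsilon>
    by (simp add: m_def \<tau>_label sgn)
  have decreasing: "(m e', m e) \<in> less_than <*lex*> flow_less H X ?T \<Phi>"
    if e'e: "(e', e) \<in> flow_less G gens tree \<Psi>" for e' e
  proof -
    have e: "e \<in> carrier G \<times> gens" "e' \<in> set (\<Psi> e)" "e \<notin> sym_edges G tree_arcs" "e' \<notin> sym_edges G tree_arcs"
      using e'e by (auto simp: flow_less_def arcs_G arcs_tree)
    from e(1) show ?thesis
    proof (cases rule: edge_cases)
      case (base g a)
      let ?h = "base_part g"
      have h: "?h \<in> carrier H" using base by simp
      obtain k b where kb: "(k, b) \<in> set (\<Phi> (?h, a))" "e' = lift_edge (base_pos g) (k, b)"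
        using e(2) by (auto simp: base(1) \<Psi>_base[OF base(3)])
      then have kc: "k \<in> carrier H" "b \<in> X" using \<Phi>_carrier[OF h base(3)] by auto
      have e': "e' = (base_pos g \<otimes>\<^bsub>G\<^esub> \<iota> k, \<iota> b)" using kb(2) by (simp add: lift_edge_def)
      \<comment> \<open>For base labels, membership in the tree depends only on base part and label,
        so the order of H reappears unchanged in each coset.\<close>
      have "((k, b), (?h, a)) \<in> flow_less H X ?T \<Phi>"
        using e(3,4) kb(1) kc h base pos(1)[OF base(2)] pos(3)[OF base(2) kc(1)]
        by (simp add: flow_less_def e' sym_tree_arcs_\<iota>) (simp add: cayley_graph_eq_sub)
      then show ?thesis
        using kc base pos(3)[OF base(2) kc(1)] by (simp add: e' m_base)
    next
      case (stable g \<epsilon>)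
      let ?h = "base_part g"
      have h: "?h \<in> carrier H" using stable by simp
      have ne: "left_part \<epsilon> ?h \<noteq> \<one>" using e(3) stable by (simp add: sym_tree_arcs_\<tau>)
      define s where "s = step \<epsilon> ?h"
      have s: "s \<in> C \<epsilon>" "s \<in> carrier H" and less: "l \<epsilon> (left_part \<epsilon> ?h \<otimes> s) < l \<epsilon> (left_part \<epsilon> ?h)"
        using step[OF h ne] S_C[of s \<epsilon>] C_carrier[of s \<epsilon>] by (auto simp: s_def)
      have \<phi>s: "\<phi> \<epsilon> (inv s) \<in> carrier H"
        using \<phi>_carrier subgroup.m_inv_closed[OF C_subgroup s(1)] by simp
      have "e' \<in> set (detour \<epsilon> g s)"
        using e(2) ne by (simp add: stable(1) \<Psi>_stable s_def)
      \<comment> \<open>Apart from the single crossing, every edge of the detour carries a base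
        label and has smaller measure at once; at the crossing the index c has become c s.\<close>
      then consider "snd e' \<in> set (word s) \<union> set (word (\<phi> \<epsilon> (inv s)))" | "e' = (g \<otimes>\<^bsub>G\<^esub> \<iota> s, \<tau> \<epsilon>)"
        unfolding detour_def by (auto dest: snd_word_path)
      then show ?thesis
      proof cases
        case 1
        then have "snd e' \<in> \<iota> ` X" using word(2)[OF s(2)] word(2)[OF \<phi>s] by blast
        then obtain k b where "e' = (k, \<iota> b)" "b \<in> X" by (cases e') auto
        then show ?thesis by (simp add: m_base m_stable stable(1))
      next
        case 2
        have "left_part \<epsilon> (base_part (g \<otimes>\<^bsub>G\<^esub> \<iota> s)) = left_part \<epsilon> ?h \<otimes> s"
          using stable(2) s h by (simp add: base_part_\<iota> left_part_mult)
        then show ?thesis using less by (simp add: 2 m_stable stable(1))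
      qed
    qed
  qed
  have "wf ((flow_less H X ?T \<Phi>)\<^sup>+)" using flow by (simp add: flow_function_def)
  then have "wf (flow_less H X ?T \<Phi>)" by (rule wf_subset) (intro subsetI r_into_trancl')
  then have "wf (inv_image (less_than <*lex*> flow_less H X ?T \<Phi>) m)"
    by (intro wf_inv_image wf_lex_prod wf_less_than)
  then have "wf (flow_less G gens tree \<Psi>)"
    by (rule wf_subset) (use decreasing in \<open>auto simp only: in_inv_image\<close>)
  then have wf: "wf ((flow_less G gens tree \<Psi>)\<^sup>+)" by (rule wf_trancl)
  have "irrefl ((flow_less G gens tree \<Psi>)\<^sup>+)"
    using wf_irrefl[OF wf] by (auto simp: irrefl_def)
  then have flow_G: "flow_function G gens tree \<Psi>"
    using walk fixed wf by (simp add: flow_function_def arcs_G arcs_tree)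

  obtain K where K: "\<And>e. e \<in> carrier H \<times> X \<Longrightarrow> length (\<Phi> e) \<le> K"
    using bounded by (auto simp: bounded_flow_def cayley_graph_eq_sub)
  \<comment> \<open>The lengths of all detours: two exponents, finitely many multipliers for each,
    and \<open>Suc\<close> for the crossing.\<close>
  let ?N = "(\<lambda>(\<epsilon>, s). length (w s) + Suc (length (w (\<phi> \<epsilon> (inv s))))) ` (SIGMA \<epsilon>:UNIV. S \<epsilon>)"
  have "finite ?N" using S_finite by (intro finite_imageI finite_SigmaI) auto
  then obtain L where L: "\<forall>n\<in>?N. n \<le> L" unfolding finite_nat_set_iff_bounded_le by blast
  have "length (\<Psi> e) \<le> K + L + 1" if "e \<in> carrier G \<times> gens" for e
    using that
  proof (cases rule: edge_cases)
    case (base g a)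
    then show ?thesis using K[of "(base_part g, a)"] by (simp add: \<Psi>_base)
  next
    case (stable g \<epsilon>)
    show ?thesis
    proof (cases "left_part \<epsilon> (base_part g) = \<one>")
      case True
      then show ?thesis by (simp add: stable(1) \<Psi>_stable)
    next
      case False
      let ?s = "step \<epsilon> (base_part g)"
      have "?s \<in> S \<epsilon>" using step[OF _ False] stable(2) by simp
      then have "length (w ?s) + Suc (length (w (\<phi> \<epsilon> (inv ?s)))) \<in> ?N"
        by (intro image_eqI[of _ _ "(\<epsilon>, ?s)"]) auto
      then have "length (w ?s) + Suc (length (w (\<phi> \<epsilon> (inv ?s)))) \<le> L" using L by blast
      then show ?thesis
        using False by (simp add: stable(1) \<Psi>_stable detour_def word_def)
    qed
  qed
  then have "bounded_flow G gens \<Psi>" unfolding bounded_flow_def arcs_G by blast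
  then show ?thesis
    using maximal_tree flow_G unfolding stackable_over_def by blast
qed

end

section \<open>The HNN extension as a group of words\<close>

locale hnn = group H for H (structure) +
  fixes A B :: "'a set" and \<psi> :: "'a \<Rightarrow> 'a"
  assumes A: "subgroup A H" and B: "subgroup B H"
    and \<psi>_iso: "\<psi> \<in> iso (H\<lparr>carrier := A\<rparr>) (H\<lparr>carrier := B\<rparr>)"
begin

lemma \<psi>_bij: "bij_betw \<psi> A B"
  using \<psi>_iso by (simp add: iso_def)

lemma \<psi>_closed: "a \<in> A \<Longrightarrow> \<psi> a \<in> B"
  using \<psi>_bij by (auto simp: bij_betw_def)

lemma \<psi>_mult: "a \<in> A \<Longrightarrow> b \<in> A \<Longrightarrow> \<psi> (a \<otimes> b) = \<psi> a \<otimes> \<psi> b"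
  using \<psi>_iso by (auto simp: iso_def hom_def)

lemma A_carrier: "a \<in> A \<Longrightarrow> a \<in> carrier H" and B_carrier: "b \<in> B \<Longrightarrow> b \<in> carrier H"
  using subgroup.mem_carrier[OF A] subgroup.mem_carrier[OF B] by simp_all

text \<open>From \<open>s a s\<inverse> = \<psi>(a)\<close> follow \<open>\<psi>(a) s = s a\<close>
  and \<open>a s\<inverse> = s\<inverse> \<psi>(a)\<close>: elements of \<open>B\<close> pass
  through \<open>s\<close> by the inverse of \<open>\<psi>\<close>, elements of \<open>A\<close>
  pass through \<open>s\<inverse>\<close> by \<open>\<psi>\<close>.\<close>

definition assoc :: "bool \<Rightarrow> 'a set" where
  "assoc \<epsilon> = (if \<epsilon> then B else A)"

definition twist :: "bool \<Rightarrow> 'a \<Rightarrow> 'a" where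
  "twist \<epsilon> = (if \<epsilon> then inv_into A \<psi> else \<psi>)"

lemma \<psi>_inv_into: "b \<in> B \<Longrightarrow> inv_into A \<psi> b \<in> A" "b \<in> B \<Longrightarrow> \<psi> (inv_into A \<psi> b) = b"
  "a \<in> A \<Longrightarrow> inv_into A \<psi> (\<psi> a) = a"
  using \<psi>_bij by (auto simp: bij_betw_def inv_into_into f_inv_into_f)

lemma inv_into_mult:
  assumes "b \<in> B" "c \<in> B"
  shows "inv_into A \<psi> (b \<otimes> c) = inv_into A \<psi> b \<otimes> inv_into A \<psi> c"
proof -
  let ?a = "inv_into A \<psi> b" and ?d = "inv_into A \<psi> c"
  have "?a \<otimes> ?d \<in> A" using \<psi>_inv_into(1) assms subgroup.m_closed[OF A] by blast
  then have "inv_into A \<psi> (\<psi> (?a \<otimes> ?d)) = ?a \<otimes> ?d" by (rule \<psi>_inv_into)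
  then show ?thesis using assms by (simp add: \<psi>_mult \<psi>_inv_into)
qed

sublocale hnn_action H assoc twist
proof (intro_locales, rule hnn_action_axioms.intro)
  show "subgroup (assoc \<epsilon>) H" for \<epsilon>
    using A B by (simp add: assoc_def)
  show "twist \<epsilon> c \<in> assoc (\<not> \<epsilon>)" if "c \<in> assoc \<epsilon>" for c \<epsilon>
    using that by (cases \<epsilon>) (auto simp: assoc_def twist_def \<psi>_closed \<psi>_inv_into)
  show "twist \<epsilon> (c \<otimes> d) = twist \<epsilon> c \<otimes> twist \<epsilon> d" if "c \<in> assoc \<epsilon>" "d \<in> assoc \<epsilon>" for c d \<epsilon>
    using that by (cases \<epsilon>) (auto simp: assoc_def twist_def \<psi>_mult inv_into_mult)
  show "twist (\<not> \<epsilon>) (twist \<epsilon> c) = c" if "c \<in> assoc \<epsilon>" for c \<epsilon>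
    using that by (cases \<epsilon>) (auto simp: assoc_def twist_def \<psi>_inv_into)
qed

section \<open>Words modulo the congruence form a group\<close>

abbreviation "words \<equiv> hnn_words H"
abbreviation "cong \<equiv> hnn_cong H A \<psi>"
abbreviation "Ext \<equiv> hnn_extension H A \<psi>"

definition cl :: "'a hnn_letter list \<Rightarrow> 'a hnn_letter list set" where
  "cl w = cong `` {w}"

lemma words_simps [simp]:
  "[] \<in> words" "Base h # w \<in> words \<longleftrightarrow> h \<in> carrier H \<and> w \<in> words"
  "Stable # w \<in> words \<longleftrightarrow> w \<in> words" "Stable_inv # w \<in> words \<longleftrightarrow> w \<in> words"
  "u @ v \<in> words \<longleftrightarrow> u \<in> words \<and> v \<in> words"
  by (auto simp: hnn_words_def)

lemma words_letterE:
  assumes "[x] \<in> words"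
  obtains (Base) h where "x = Base h" "h \<in> carrier H" | (Stable) "x = Stable" | (Stable_inv) "x = Stable_inv"
  using assms by (cases x) auto

lemma words_ConsD: "x # w \<in> words \<Longrightarrow> [x] \<in> words \<and> w \<in> words"
  by (cases x) auto

lemma relator_words: "(l, r) \<in> hnn_relators H A \<psi> \<Longrightarrow> l \<in> words \<and> r \<in> words"
  by (induction rule: hnn_relators.induct) (auto simp: A_carrier B_carrier \<psi>_closed)

lemma cong_words: "(u, v) \<in> cong \<Longrightarrow> u \<in> words \<and> v \<in> words"
  by (induction rule: hnn_cong.induct) (auto dest: relator_words)

lemma equiv_cong: "equiv words cong"
  by (intro equivI refl_onI symI transI)
    (auto dest: cong_words intro: hnn_cong.refl hnn_cong.sym hnn_cong.trans)

lemma cong_append_left: "(u, v) \<in> cong \<Longrightarrow> w \<in> words \<Longrightarrow> (w @ u, w @ v) \<in> cong"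
proof (induction rule: hnn_cong.induct)
  case (step u v l r)
  then show ?case using hnn_cong.step[of "w @ u" H v l r A \<psi>] by simp
qed (auto intro: hnn_cong.refl hnn_cong.sym hnn_cong.trans)

lemma cong_append_right: "(u, v) \<in> cong \<Longrightarrow> w \<in> words \<Longrightarrow> (u @ w, v @ w) \<in> cong"
proof (induction rule: hnn_cong.induct)
  case (step u v l r)
  then show ?case using hnn_cong.step[of u H "v @ w" l r A \<psi>] by simp
qed (auto intro: hnn_cong.refl hnn_cong.sym hnn_cong.trans)

lemma cl_eq_iff: "u \<in> words \<Longrightarrow> v \<in> words \<Longrightarrow> cl u = cl v \<longleftrightarrow> (u, v) \<in> cong"
  unfolding cl_def using equiv_cong by (rule eq_equiv_class_iff)

lemma cl_cong: "(u, v) \<in> cong \<Longrightarrow> cl u = cl v"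
  using cong_words cl_eq_iff by blast

lemma cl_relator: "(l, r) \<in> hnn_relators H A \<psi> \<Longrightarrow> cl l = cl r"
  using hnn_cong.step[of "[]" H "[]" l r A \<psi>] by (intro cl_cong) simp

lemma carrier_Ext: "carrier Ext = cl ` words"
  by (auto simp: hnn_extension_def quotient_def cl_def)

lemma one_Ext: "\<one>\<^bsub>Ext\<^esub> = cl []"
  by (simp add: hnn_extension_def cl_def)

text \<open>The union over all representatives collapses to one class because the congruence is
  compatible with concatenation on both sides.\<close>

lemma mult_Ext:
  assumes "u \<in> words" "v \<in> words"
  shows "cl u \<otimes>\<^bsub>Ext\<^esub> cl v = cl (u @ v)"
proof -
  have "cl (u' @ v') = cl (u @ v)" if "u' \<in> cl u" "v' \<in> cl v" for u' v'
  proof -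
    have uv: "(u, u') \<in> cong" "(v, v') \<in> cong" using that by (auto simp: cl_def)
    then have "(u @ v, u' @ v) \<in> cong" "(u' @ v, u' @ v') \<in> cong"
      using cong_append_right cong_append_left cong_words assms by blast+
    then have "(u @ v, u' @ v') \<in> cong" by (rule hnn_cong.trans)
    then show ?thesis using cl_cong by simp
  qed
  moreover have "u \<in> cl u" "v \<in> cl v" using assms by (auto simp: cl_def intro: hnn_cong.refl)
  ultimately show ?thesis
    unfolding hnn_extension_def monoid.simps partial_object.simps cl_def[symmetric] by blast
qed

lemma left_inverse_word:
  "w \<in> words \<Longrightarrow> \<exists>w'\<in>words. cl (w' @ w) = cl []"
proof (induction w)
  case Nil
  then show ?case by (intro bexI[of _ "[]"]) auto
next
  case (Cons x w)
  then have x: "[x] \<in> words" and w: "w \<in> words" using words_ConsD by blast+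
  then obtain w' where w': "w' \<in> words" "cl (w' @ w) = cl []" using Cons.IH by blast
  have "\<exists>y. [y] \<in> words \<and> cl [y, x] = cl []"
    using x
  proof (cases rule: words_letterE)
    case (Base h)
    then have "cl [Base (inv h), x] = cl [Base \<one>]"
      using cl_relator[OF hnn_relators.mult, of "inv h" h] by simp
    then show ?thesis
      using Base cl_relator[OF hnn_relators.one] by (intro exI[of _ "Base (inv h)"]) simp
  next
    case Stable
    then show ?thesis
      using cl_relator[OF hnn_relators.cancel'] by (intro exI[of _ Stable_inv]) simp
  next
    case Stable_inv
    then show ?thesis
      using cl_relator[OF hnn_relators.cancel] by (intro exI[of _ Stable]) simp
  qed
  then obtain y where y: "[y] \<in> words" "cl [y, x] = cl []" by blast
  have xw: "x # w = [x] @ w" and yx: "[y, x] = [y] @ [x]" by simp_all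
  have "([y, x], []) \<in> cong" using y x by (subst cl_eq_iff[symmetric]) (simp_all add: yx del: append_Cons append_Nil)
  then have "(w' @ [y, x] @ w, w' @ [] @ w) \<in> cong"
    using cong_append_left cong_append_right w w' by blast
  then have "cl ((w' @ [y]) @ x # w) = cl []" using cl_cong w'(2) by simp
  then show ?case using w' y by (intro bexI[of _ "w' @ [y]"]) simp_all
qed

lemma group_Ext: "group Ext"
proof (rule groupI)
  fix x y z assume "x \<in> carrier Ext" "y \<in> carrier Ext" "z \<in> carrier Ext"
  then show "x \<otimes>\<^bsub>Ext\<^esub> y \<otimes>\<^bsub>Ext\<^esub> z = x \<otimes>\<^bsub>Ext\<^esub> (y \<otimes>\<^bsub>Ext\<^esub> z)"
    by (auto simp: carrier_Ext mult_Ext)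
next
  fix x assume "x \<in> carrier Ext"
  then obtain w where w: "w \<in> words" "x = cl w" by (auto simp: carrier_Ext)
  then show "\<one>\<^bsub>Ext\<^esub> \<otimes>\<^bsub>Ext\<^esub> x = x" by (simp add: one_Ext mult_Ext)
  obtain w' where "w' \<in> words" "cl (w' @ w) = cl []" using left_inverse_word w by blast
  then show "\<exists>y\<in>carrier Ext. y \<otimes>\<^bsub>Ext\<^esub> x = \<one>\<^bsub>Ext\<^esub>"
    using w by (intro bexI[of _ "cl w'"]) (auto simp: one_Ext mult_Ext carrier_Ext)
qed (auto simp: carrier_Ext mult_Ext one_Ext)

sublocale Ext: group Ext
  by (rule group_Ext)

definition base :: "'a \<Rightarrow> 'a hnn_letter list set" where
  "base h = cl [Base h]"

definition stable :: "bool \<Rightarrow> 'a hnn_letter list set" where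
  "stable \<epsilon> = cl [if \<epsilon> then Stable else Stable_inv]"

lemma base_closed [simp]: "h \<in> carrier H \<Longrightarrow> base h \<in> carrier Ext"
  by (auto simp: base_def carrier_Ext)

lemma stable_closed [simp]: "stable \<epsilon> \<in> carrier Ext"
  by (auto simp: stable_def carrier_Ext)

lemma base_mult: "h \<in> carrier H \<Longrightarrow> k \<in> carrier H \<Longrightarrow> base (h \<otimes> k) = base h \<otimes>\<^bsub>Ext\<^esub> base k"
  using cl_relator[OF hnn_relators.mult, of h k] by (simp add: base_def mult_Ext)

lemma base_one: "base \<one> = \<one>\<^bsub>Ext\<^esub>"
  using cl_relator[OF hnn_relators.one] by (simp add: base_def one_Ext)

lemma stable_cancel: "stable (\<not> \<epsilon>) \<otimes>\<^bsub>Ext\<^esub> stable \<epsilon> = \<one>\<^bsub>Ext\<^esub>"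
  using cl_relator[OF hnn_relators.cancel] cl_relator[OF hnn_relators.cancel']
  by (simp add: stable_def mult_Ext one_Ext)

lemma inv_stable: "inv\<^bsub>Ext\<^esub> stable \<epsilon> = stable (\<not> \<epsilon>)"
  using stable_cancel by (intro Ext.inv_equality) auto

lemma stable_conj: "a \<in> A \<Longrightarrow> stable True \<otimes>\<^bsub>Ext\<^esub> base a \<otimes>\<^bsub>Ext\<^esub> stable False = base (\<psi> a)"
  using cl_relator[OF hnn_relators.conj, of a] by (simp add: stable_def base_def mult_Ext A_carrier)

text \<open>The conjugation relation as a commutation rule: multiply by \<open>s\<close> on the
  right for \<open>B\<close>, by \<open>s\<inverse>\<close> on the left for
  \<open>A\<close>.\<close>

lemma base_stable:
  assumes "c \<in> assoc \<epsilon>"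
  shows "base c \<otimes>\<^bsub>Ext\<^esub> stable \<epsilon> = stable \<epsilon> \<otimes>\<^bsub>Ext\<^esub> base (twist \<epsilon> c)"
proof (cases \<epsilon>)
  case True
  define a where "a = twist \<epsilon> c"
  have a: "a \<in> A" "\<psi> a = c" using assms True by (auto simp: a_def twist_def assoc_def \<psi>_inv_into)
  have "base c = stable True \<otimes>\<^bsub>Ext\<^esub> base a \<otimes>\<^bsub>Ext\<^esub> stable False"
    unfolding stable_conj[OF a(1)] a(2) ..
  then have "base c \<otimes>\<^bsub>Ext\<^esub> stable True =
      stable True \<otimes>\<^bsub>Ext\<^esub> base a \<otimes>\<^bsub>Ext\<^esub> (stable False \<otimes>\<^bsub>Ext\<^esub> stable True)"
    using A_carrier[OF a(1)] by (simp add: Ext.m_assoc)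
  then show ?thesis using stable_cancel[of True] A_carrier[OF a(1)] True by (simp add: a_def)
next
  case False
  then have c: "c \<in> A" using assms by (simp add: assoc_def)
  have "stable False \<otimes>\<^bsub>Ext\<^esub> base (\<psi> c) =
      (stable False \<otimes>\<^bsub>Ext\<^esub> stable True) \<otimes>\<^bsub>Ext\<^esub> (base c \<otimes>\<^bsub>Ext\<^esub> stable False)"
    unfolding stable_conj[OF c, symmetric] using A_carrier[OF c] by (simp add: Ext.m_assoc)
  then show ?thesis using stable_cancel[of True] A_carrier[OF c] False by (simp add: twist_def)
qed

lemma cl_generate: "w \<in> words \<Longrightarrow> cl w \<in> generate Ext (base ` carrier H \<union> range stable)"
proof (induction w)
  case Nil
  then show ?case using generate.one[of Ext] by (simp add: one_Ext)
next
  case (Cons x w)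
  then have x: "[x] \<in> words" and w: "w \<in> words" using words_ConsD by blast+
  have "cl [x] \<in> base ` carrier H \<union> range stable"
    using x by (cases rule: words_letterE) (auto simp: base_def stable_def image_iff intro: exI[of _ True] exI[of _ False])
  moreover have "cl (x # w) = cl [x] \<otimes>\<^bsub>Ext\<^esub> cl w" using x w by (simp add: mult_Ext)
  ultimately show ?case using Cons.IH[OF w] by (auto intro: generate.intros)
qed

section \<open>Words acting on normal forms\<close>

fun letter_act :: "(bool \<times> 'a) list \<times> 'a \<Rightarrow> 'a hnn_letter \<Rightarrow> (bool \<times> 'a) list \<times> 'a" where
  "letter_act x (Base k) = (fst x, snd x \<otimes> k)"
| "letter_act x Stable = act True x"
| "letter_act x Stable_inv = act False x"

lemma letter_act_closed: "x \<in> states \<Longrightarrow> [y] \<in> words \<Longrightarrow> letter_act x y \<in> states"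
  by (cases y) (auto simp: act_closed, auto simp: states_def)

lemma run_closed: "w \<in> words \<Longrightarrow> x \<in> states \<Longrightarrow> foldl letter_act x w \<in> states"
proof (induction w arbitrary: x)
  case (Cons y w)
  then show ?case using words_ConsD letter_act_closed by simp
qed simp

text \<open>Cancellation is \<open>act_act\<close>; for conjugation, \<open>act_mult\<close> first
  moves the element past the stable letter and \<open>act_act\<close> then cancels.\<close>

lemma run_relator:
  assumes "(u, v) \<in> hnn_relators H A \<psi>" "x \<in> states"
  shows "foldl letter_act x u = foldl letter_act x v"
  using assms(1)
proof cases
  case (conj a)
  obtain n h where x: "x = (n, h)" by (cases x)
  have h: "h \<in> carrier H" using assms(2) x by (simp add: states_def)
  have \<psi>a: "\<psi> a \<in> assoc True" "twist True (\<psi> a) = a"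
    using conj by (auto simp: assoc_def twist_def \<psi>_closed \<psi>_inv_into)
  \<comment> \<open>\<open>act_mult\<close> read backwards: multiplying by \<open>a\<close> after
    crossing \<open>s\<close> equals multiplying by \<open>\<psi> a\<close> before.\<close>
  have "foldl letter_act x u = act False (act True (n, h \<otimes> \<psi> a))"
    using act_mult[of n h "\<psi> a" True] assms(2) \<psi>a unfolding conj x by (simp add: map_prod_def split: prod.splits)
  also have "\<dots> = (n, h \<otimes> \<psi> a)"
    using act_act[of "(n, h \<otimes> \<psi> a)" True] assms(2) x C_carrier[OF \<psi>a(1)] by (simp add: states_def)
  finally show ?thesis unfolding conj x by simp
qed (use assms(2) act_act[OF assms(2), of True] act_act[OF assms(2), of False] in
    \<open>auto simp: states_def m_assoc\<close>)

lemma run_cong: "(u, v) \<in> cong \<Longrightarrow> x \<in> states \<Longrightarrow> foldl letter_act x u = foldl letter_act x v"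
proof (induction arbitrary: x rule: hnn_cong.induct)
  case (step u v l r)
  then show ?case using run_relator run_closed by simp
qed auto

text \<open>The chosen word is immaterial: congruent words lead to the same state by
  \<open>run_cong\<close>.\<close>

definition normal_form :: "'a hnn_letter list set \<Rightarrow> (bool \<times> 'a) list \<times> 'a" where
  "normal_form g = foldl letter_act ([], \<one>) (SOME w. w \<in> g)"

lemma normal_form_cl:
  assumes "w \<in> words"
  shows "normal_form (cl w) = foldl letter_act ([], \<one>) w"
proof -
  have "w \<in> cl w" using assms by (auto simp: cl_def intro: hnn_cong.refl)
  then have "(SOME w'. w' \<in> cl w) \<in> cl w" by (rule someI)
  then have "(w, SOME w'. w' \<in> cl w) \<in> cong" by (simp add: cl_def)
  then show ?thesis
    unfolding normal_form_def by (intro run_cong[symmetric]) (auto simp: states_def)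
qed

fun eval_prefix :: "(bool \<times> 'a) list \<Rightarrow> 'a hnn_letter list set" where
  "eval_prefix [] = \<one>\<^bsub>Ext\<^esub>"
| "eval_prefix ((\<epsilon>, r) # n) = eval_prefix n \<otimes>\<^bsub>Ext\<^esub> base r \<otimes>\<^bsub>Ext\<^esub> stable \<epsilon>"

definition eval_state :: "(bool \<times> 'a) list \<times> 'a \<Rightarrow> 'a hnn_letter list set" where
  "eval_state = (\<lambda>(n, h). eval_prefix n \<otimes>\<^bsub>Ext\<^esub> base h)"

lemma eval_prefix_closed: "reduced n \<Longrightarrow> eval_prefix n \<in> carrier Ext"
  by (induction n rule: reduced.induct) auto

text \<open>Split \<open>h\<close> into its representative and its part in the subgroup, and move
  the latter past the stable letter. A push records exactly this; a pop then cancels two opposite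
  stable letters.\<close>

lemma eval_state_act:
  assumes "x \<in> states"
  shows "eval_state (act \<epsilon> x) = eval_state x \<otimes>\<^bsub>Ext\<^esub> stable \<epsilon>"
proof -
  obtain n h where x: "x = (n, h)" by (cases x)
  then have h: "h \<in> carrier H" and n: "reduced n" using assms by (auto simp: states_def)
  let ?c = "left_part \<epsilon> h" and ?r = "left_rep (assoc \<epsilon>) h"
  have c: "?c \<in> assoc \<epsilon>" by (rule left_part_closed[OF h])
  have r: "?r \<in> carrier H" using C_subgroup h by simp
  have "base h = base ?r \<otimes>\<^bsub>Ext\<^esub> base ?c"
    using base_mult[OF r C_carrier[OF c]] left_rep_left_part[OF h] by simp
  then have "base h \<otimes>\<^bsub>Ext\<^esub> stable \<epsilon> = base ?r \<otimes>\<^bsub>Ext\<^esub> (base ?c \<otimes>\<^bsub>Ext\<^esub> stable \<epsilon>)"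
    using r C_carrier[OF c] by (simp add: Ext.m_assoc)
  then have move: "base h \<otimes>\<^bsub>Ext\<^esub> stable \<epsilon> = base ?r \<otimes>\<^bsub>Ext\<^esub> (stable \<epsilon> \<otimes>\<^bsub>Ext\<^esub> base (twist \<epsilon> ?c))"
    by (simp only: base_stable[OF c])
  have eval_x: "eval_state x \<otimes>\<^bsub>Ext\<^esub> stable \<epsilon> =
      eval_prefix n \<otimes>\<^bsub>Ext\<^esub> (base ?r \<otimes>\<^bsub>Ext\<^esub> (stable \<epsilon> \<otimes>\<^bsub>Ext\<^esub> base (twist \<epsilon> ?c)))"
    using eval_prefix_closed[OF n] h by (simp add: x eval_state_def Ext.m_assoc flip: move)
  note c' = \<phi>_carrier[OF c]
  show ?thesis
  proof (cases rule: act_cases[of \<epsilon> h n])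
    case (pop r' n')
    then have r': "r' \<in> carrier H" and n': "eval_prefix n' \<in> carrier Ext"
      using n eval_prefix_closed by auto
    have "eval_state x \<otimes>\<^bsub>Ext\<^esub> stable \<epsilon> = eval_prefix n' \<otimes>\<^bsub>Ext\<^esub> base r' \<otimes>\<^bsub>Ext\<^esub>
        ((stable (\<not> \<epsilon>) \<otimes>\<^bsub>Ext\<^esub> stable \<epsilon>) \<otimes>\<^bsub>Ext\<^esub> base (twist \<epsilon> ?c))"
      unfolding eval_x using pop(1,2) r' n' c' by (simp add: base_one Ext.m_assoc)
    then show ?thesis
      using r' n' c' by (simp add: x pop(3) eval_state_def base_mult stable_cancel Ext.m_assoc)
  next
    case push
    show ?thesis
      unfolding eval_x using push(2) eval_prefix_closed[OF n] r c'
      by (simp add: x eval_state_def Ext.m_assoc)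
  qed
qed

lemma eval_state_base:
  assumes "x \<in> states" "k \<in> carrier H"
  shows "eval_state (fst x, snd x \<otimes> k) = eval_state x \<otimes>\<^bsub>Ext\<^esub> base k"
  using assms eval_prefix_closed
  by (auto simp: states_def eval_state_def base_mult Ext.m_assoc)

text \<open>The state reached by a word determines its class, so a trivial normal form forces the
  identity.\<close>

lemma eval_normal_form:
  "w \<in> words \<Longrightarrow> eval_state (foldl letter_act ([], \<one>) w) = cl w"
proof (induction w rule: rev_induct)
  case Nil
  then show ?case by (simp add: eval_state_def base_one one_Ext[symmetric])
next
  case (snoc x w)
  then have x: "[x] \<in> words" and w: "w \<in> words" by auto
  let ?s = "foldl letter_act ([], \<one>) w"
  have s: "?s \<in> states" using run_closed[OF w] by (simp add: states_def)
  have "eval_state (letter_act ?s x) = eval_state ?s \<otimes>\<^bsub>Ext\<^esub> cl [x]"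
    using x
  proof (cases rule: words_letterE)
    case (Base h)
    then show ?thesis using eval_state_base[OF s, of h] by (simp add: base_def)
  next
    case Stable
    then show ?thesis using eval_state_act[OF s, of True] by (simp add: stable_def)
  next
    case Stable_inv
    then show ?thesis using eval_state_act[OF s, of False] by (simp add: stable_def)
  qed
  then show ?case using snoc.IH[OF w] x w by (simp add: mult_Ext)
qed

sublocale hnn_normal_form H assoc twist Ext base stable normal_form
proof unfold_locales
  show "base \<in> hom H Ext"
    by (auto simp: hom_def base_mult)
  show "generate Ext (base ` carrier H \<union> range stable) = carrier Ext"
  proof
    show "generate Ext (base ` carrier H \<union> range stable) \<subseteq> carrier Ext"
      by (intro Ext.generate_incl) auto
    show "carrier Ext \<subseteq> generate Ext (base ` carrier H \<union> range stable)"
      unfolding carrier_Ext using cl_generate by blast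
  qed
  show "normal_form g \<in> states" if "g \<in> carrier Ext" for g
    using that run_closed by (auto simp: carrier_Ext normal_form_cl states_def)
  show "normal_form \<one>\<^bsub>Ext\<^esub> = ([], \<one>)"
    by (simp add: one_Ext normal_form_cl)
  show "normal_form (g \<otimes>\<^bsub>Ext\<^esub> base k) = (fst (normal_form g), snd (normal_form g) \<otimes> k)"
    if "g \<in> carrier Ext" "k \<in> carrier H" for g k
    using that by (auto simp: carrier_Ext base_def mult_Ext normal_form_cl)
  show "normal_form (g \<otimes>\<^bsub>Ext\<^esub> stable \<epsilon>) = act \<epsilon> (normal_form g)" if "g \<in> carrier Ext" for g \<epsilon>
    using that by (cases \<epsilon>) (auto simp: carrier_Ext stable_def mult_Ext normal_form_cl)
  show "g = \<one>\<^bsub>Ext\<^esub>" if g: "g \<in> carrier Ext" and nf: "normal_form g = ([], \<one>)" for g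
  proof -
    obtain w where w: "w \<in> words" "g = cl w" using g by (auto simp: carrier_Ext)
    then have "g = eval_state (normal_form g)"
      using eval_normal_form by (simp add: normal_form_cl)
    then show ?thesis unfolding nf by (simp add: eval_state_def base_one)
  qed
qed (simp_all add: inv_stable base_stable)

end

theorem theorem4p4:
  fixes H :: "('a, 'b) monoid_scheme"
    and A B :: "'a set"
    and \<psi> :: "'a \<Rightarrow> 'a"
  assumes "stackable H"
    and "fin_gen_subgroup A H"
    and "fin_gen_subgroup B H"
    and "\<psi> \<in> iso (H\<lparr>carrier := A\<rparr>) (H\<lparr>carrier := B\<rparr>)"
  shows "stackable (hnn_extension H A \<psi>)"
proof -
  obtain X T \<Phi> where H: "group H" and X: "inv_closed_gen_set H X" and T: "maximal_tree H X T"
    and \<Phi>: "flow_function H X T \<Phi>" "bounded_flow H X \<Phi>"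
    using assms(1) by (auto simp: stackable_def stackable_over_def)
  interpret hnn H A B \<psi>
    using H assms(2-4) by (auto simp: hnn_def hnn_axioms_def fin_gen_subgroup_def)
  interpret X: cayley H X
    using X by unfold_locales
  obtain P where P: "parent_arcs H X \<one>\<^bsub>H\<^esub> (carrier H) P"
    and T_eq: "T = cayley_sub H (carrier H) (sym_edges H P)"
    using X.maximal_treeE[OF T one_closed] .
  interpret hnn_stacking H assoc twist Ext base stable normal_form X P
    using P by unfold_locales
  have "\<exists>S. finite S \<and> S \<subseteq> carrier H \<and> generate H S = assoc \<epsilon>" for \<epsilon>
    using assms(2,3) by (simp add: assoc_def fin_gen_subgroup_def)
  then have "stackable_over Ext gens"
    using \<Phi> unfolding T_eq by (rule stackable_over_gens)
  then show ?thesis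
    using group_Ext inv_closed_gen_set_gens by (auto simp: stackable_def)
qed

end
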